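(* Let $f>2$ be an integer and $\tau>1$. Every minimizer $\rho$ of the action $S$ on the flag manifold $F=F^{1,2}(\mathbb{C}^f)$ (with parameter $\tau$) is generically timelike, or the interior of $\operatorname{supp}\rho$ is empty (or both).
   Context: For a real parameter $\tau>1$ and an integer $f>2$, let $F$ be the space of Hermitian $f\times f$-matrices of rank two whose non-trivial eigenvalues are equal to $1+\tau$ and $1-\tau$. Associating to $x\in F$ its eigenspaces $U$ (for $1+\tau$) and $V$ (for $1-\tau$) and the chain $U\subset U\oplus V$, $F$ is identified with the flag manifold $F^{1,2}(\mathbb{C}^f)$ of one-dimensional subspaces contained in a two-dimensional subspace of $\mathbb{C}^f$; it is a $(4f-6)$-dimensional compact manifold and a homogeneous space of $U(f)$ under $x\mapsto UxU^{-1}$. Define $$D(x,y)=\operatorname{Tr}\big((xy)^2\big)-\tfrac12\big(\operatorname{Tr}(xy)\big)^2,\qquad L=\max(0,D).$$ $\mathfrak{M}$ is the set of all normalized (total mass one) positive regular Borel measures on $F$; $S[\rho]=\iint_{F\times F}L(x,y)\,d\rho(x)\,d\rho(y)$. A minimizer is a $\rho\in\mathfrak{M}$ with $S[\rho]=\inf_{\tilde\rho\in\mathfrak{M}}S[\tilde\rho]$. A minimizer $\rho$ is called generically timelike if (i) $D(x,y)\ge0$ for all $x,y\in\operatorname{supp}\rho$, and (ii) the function $d(x)=\int_FD(x,y)\,d\rho(y)$ is constant on $F$. The interior of $\operatorname{supp}\rho$ is taken in $F$. *)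

theory Defs
  imports "HOL-Analysis.Analysis" "HOL-Probability.Probability_Measure"
begin

definition hermitian_mat :: "complex ^ 'n ^ 'n \<Rightarrow> bool" where
  "hermitian_mat A \<longleftrightarrow> map_matrix cnj (transpose A) = A"

definition eigenvals :: "complex ^ 'n ^ 'n \<Rightarrow> complex set" where
  "eigenvals A = {c. \<exists>v. v \<noteq> 0 \<and> A *v v = c *s v}"

text \<open>
  The size of the matrices is \<open>CARD('n)\<close>.  A Hermitian matrix of rank two whose set of non-zero
  eigenvalues is a two-element set has each of these eigenvalues with multiplicity one.  The
  topology and the Borel sets of the flag manifold are those induced by the space of matrices.
\<close>
definition flagmf :: "real \<Rightarrow> (complex ^ 'n ^ 'n) set" where
  "flagmf \<tau> = {x. hermitian_mat x \<and> rank x = 2 \<and>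
     eigenvals x - {0} = {complex_of_real (1 + \<tau>), complex_of_real (1 - \<tau>)}}"

text \<open>
  The traces below are real for Hermitian \<open>x\<close> and \<open>y\<close> (shown underneath), so taking real parts
  only changes the type.
\<close>
definition Dfun :: "complex ^ 'n ^ 'n \<Rightarrow> complex ^ 'n ^ 'n \<Rightarrow> real" where
  "Dfun x y = Re (trace ((x ** y) ** (x ** y))) - 1/2 * (Re (trace (x ** y)))\<^sup>2"

lemma trace_hermitian_real:
  fixes x y :: "complex ^ 'n ^ 'n"
  assumes x: "hermitian_mat x" and y: "hermitian_mat y"
  shows "trace (x ** y) \<in> \<real>" and "trace ((x ** y) ** (x ** y)) \<in> \<real>"
proof -
  have cnj_nth: "cnj (z $ i $ j) = z $ j $ i" if "hermitian_mat z"
    for z :: "complex ^ 'n ^ 'n" and i j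
  proof -
    have "map_matrix cnj (transpose z) $ j $ i = z $ j $ i"
      using that unfolding hermitian_mat_def by simp
    then show ?thesis by (simp add: transpose_def)
  qed
  have cnj_prod: "cnj ((x ** y) $ i $ j) = (y ** x) $ j $ i" for i j
    by (simp add: matrix_matrix_mult_def cnj_nth[OF x] cnj_nth[OF y] mult.commute)
  have "cnj (trace (x ** y)) = trace (y ** x)"
    unfolding trace_def cnj_sum cnj_prod ..
  also have "\<dots> = trace (x ** y)"
    by (rule trace_mul_sym)
  finally show "trace (x ** y) \<in> \<real>"
    by (simp only: Reals_cnj_iff)
  have "cnj (trace ((x ** y) ** (x ** y))) = trace ((y ** x) ** (y ** x))"
    by (simp add: trace_def matrix_matrix_mult_def[of "x ** y"]
        matrix_matrix_mult_def[of "y ** x"] cnj_prod mult.commute)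
  also have "\<dots> = trace (y ** (x ** y ** x))"
    by (simp only: matrix_mul_assoc)
  also have "\<dots> = trace ((x ** y ** x) ** y)"
    by (rule trace_mul_sym)
  also have "\<dots> = trace ((x ** y) ** (x ** y))"
    by (simp only: matrix_mul_assoc)
  finally show "trace ((x ** y) ** (x ** y)) \<in> \<real>"
    by (simp only: Reals_cnj_iff)
qed

definition Lfun :: "complex ^ 'n ^ 'n \<Rightarrow> complex ^ 'n ^ 'n \<Rightarrow> real" where
  "Lfun x y = max 0 (Dfun x y)"

definition regular_borel_on :: "'a::topological_space set \<Rightarrow> 'a measure \<Rightarrow> bool" where
  "regular_borel_on X M \<longleftrightarrow> sets M = sets (restrict_space borel X) \<and>
     (\<forall>B\<in>sets M.
        emeasure M B = (SUP K\<in>{K. K \<subseteq> B \<and> compact K}. emeasure M K) \<and>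
        emeasure M B = (INF U\<in>{U. B \<subseteq> U \<and> openin (top_of_set X) U}. emeasure M U))"

definition normalized_measures :: "real \<Rightarrow> (complex ^ 'n ^ 'n) measure set" where
  "normalized_measures \<tau> = {\<rho>. regular_borel_on (flagmf \<tau>) \<rho> \<and> prob_space \<rho>}"

text \<open>
  The Lagrangian is continuous and bounded on the compact flag manifold, so the Bochner integral
  over the product measure exists.
\<close>
definition action :: "(complex ^ 'n ^ 'n) measure \<Rightarrow> real" where
  "action \<rho> = (\<integral>p. Lfun (fst p) (snd p) \<partial>(\<rho> \<Otimes>\<^sub>M \<rho>))"

definition minimizer :: "real \<Rightarrow> (complex ^ 'n ^ 'n) measure \<Rightarrow> bool" where
  "minimizer \<tau> \<rho> \<longleftrightarrow> \<rho> \<in> normalized_measures \<tau> \<and>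
     action \<rho> = (INF \<sigma>\<in>(normalized_measures \<tau> :: (complex ^ 'n ^ 'n) measure set). action \<sigma>)"

definition supp_on :: "'a::topological_space set \<Rightarrow> 'a measure \<Rightarrow> 'a set" where
  "supp_on X M = X - \<Union>{U. openin (top_of_set X) U \<and> emeasure M U = 0}"

definition generically_timelike :: "real \<Rightarrow> (complex ^ 'n ^ 'n) measure \<Rightarrow> bool" where
  "generically_timelike \<tau> \<rho> \<longleftrightarrow>
     (\<forall>x\<in>supp_on (flagmf \<tau>) \<rho>. \<forall>y\<in>supp_on (flagmf \<tau>) \<rho>. 0 \<le> Dfun x y) \<and>
     (\<lambda>x. \<integral>y. Dfun x y \<partial>\<rho>) constant_on flagmf \<tau>"

end

theory Submission
  imports Defs
begin

text \<open>
  On \<open>F\<close> the function \<open>D(x,y)\<close> is a bilinear pairing \<open>a(x) \<bullet> b(y)\<close> of finite-dimensional vectors, where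
  \<open>b(y)\<close> collects the quadratic monomials in the entries of \<open>y\<close>.  The second variation of the action
  makes \<open>L\<close> a positive semidefinite kernel on \<open>L\<^sup>2(\<rho>)\<close>.  Near an interior point of the support \<open>L = D\<close>
  because \<open>D(x,x) > 0\<close>, so there every function orthogonal to the components of \<open>b\<close> is a null vector
  of \<open>L\<close>.  Hence for each \<open>x\<close> in the support \<open>L(x,\<cdot>)\<close> is itself a quadratic polynomial on a small open
  set \<open>W\<close>, and by the identity theorem \<open>D(x,\<cdot>)\<close> cannot change its sign there.  On \<open>W\<close> the potential
  \<open>\<integral>L(x,y)d\<rho>(y)\<close>, which is constant on the support, thus is the polynomial \<open>\<integral>\<^sub>T D(x,y)d\<rho>(y)\<close>, where \<open>T\<close>
  consists of the \<open>y\<close> with \<open>D(y,\<cdot>) \<ge> 0\<close> on \<open>W\<close>; so this polynomial is constant on all of \<open>F\<close>.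
  Comparing it with the potential at points of the support, where \<open>L \<ge> 1\<^sub>T D\<close>, gives \<open>L(x,y) = 1\<^sub>T(y) D(x,y)\<close>
  for almost all \<open>y\<close>, which forces the support into \<open>T\<close> and \<open>D \<ge> 0\<close> on the support.
\<close>

section \<open>Regular measures and their supports\<close>

lemma openin_in_sets_restrict_borel:
  assumes "sets M = sets (restrict_space borel X)" "openin (top_of_set X) U"
  shows "U \<in> sets M"
proof -
  obtain V where "open V" "U = X \<inter> V" using assms(2) unfolding openin_open by blast
  then show ?thesis unfolding assms(1) sets_restrict_space by (intro image_eqI[of _ _ V]) auto
qed

text \<open>The new measure \<open>N\<close> is dominated by \<open>C\<close> times
  \<open>M\<close>, so a compact or relatively open set approximating \<open>B\<close> within
  \<open>e / C\<close> for \<open>M\<close> approximates it within \<open>e\<close> for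
  \<open>N\<close>. This makes the perturbed measures of the variational argument admissible
  competitors.\<close>

lemma regular_borel_on_density:
  fixes M :: "'a::t2_space measure"
  assumes reg: "regular_borel_on X M" and fin: "finite_measure M"
    and f: "f \<in> borel_measurable M" and C: "\<And>x. x \<in> space M \<Longrightarrow> f x \<le> C" and "0 < C"
  shows "regular_borel_on X (density M (\<lambda>x. ennreal (f x)))"
proof -
  define N where "N = density M (\<lambda>x. ennreal (f x))"
  have sM: "sets M = sets (restrict_space borel X)" using reg by (simp add: regular_borel_on_def)
  have sN: "sets N = sets M" by (simp add: N_def)
  have N_le: "emeasure N A \<le> ennreal C * emeasure M A" if "A \<in> sets M" for A
  proof -
    have "emeasure N A = (\<integral>\<^sup>+x. ennreal (f x) * indicator A x \<partial>M)"
      unfolding N_def using f that by (subst emeasure_density) auto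
    also have "\<dots> \<le> (\<integral>\<^sup>+x. ennreal C * indicator A x \<partial>M)"
      using C by (intro nn_integral_mono) (auto simp: indicator_def ennreal_leI)
    also have "\<dots> = ennreal C * emeasure M A" using that by (subst nn_integral_cmult_indicator) auto
    finally show ?thesis .
  qed
  have M_fin: "emeasure M A \<noteq> \<infinity>" for A
    using finite_measure.emeasure_finite[OF fin] by simp
  \<comment> \<open>For inner regularity \<open>A\<close> will be a compact subset of the given set;
    for outer regularity \<open>A\<close> will be the given set and \<open>B\<close> an open
    superset.\<close>
  have approx: "emeasure N B \<le> emeasure N A + ennreal e"
    if "A \<in> sets M" "B \<in> sets M" "A \<subseteq> B" "emeasure M B < emeasure M A + ennreal (e / C)" "0 < e" for A B e
  proof -
    have "emeasure M (B - A) + emeasure M A = emeasure M B"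
      using that by (subst plus_emeasure) (auto intro!: arg_cong[where f="emeasure M"])
    then have "emeasure M (B - A) + emeasure M A < ennreal (e / C) + emeasure M A"
      using that(4) by (simp add: add.commute)
    then have "emeasure M (B - A) \<le> ennreal (e / C)"
      using M_fin[of A] by (subst (asm) (1 2) add.commute) (simp add: ennreal_add_left_cancel_less less_imp_le)
    then have "ennreal C * emeasure M (B - A) \<le> ennreal C * ennreal (e / C)" by (rule mult_left_mono) simp
    also have "\<dots> = ennreal e" using \<open>0 < C\<close> \<open>0 < e\<close> by (subst ennreal_mult[symmetric]) auto
    finally have "emeasure N (B - A) \<le> ennreal e" using N_le[of "B - A"] that by auto
    moreover have "emeasure N B = emeasure N A + emeasure N (B - A)"
      using that sN by (subst plus_emeasure) (auto intro!: arg_cong[where f="emeasure N"])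
    ultimately show ?thesis by (simp add: add_left_mono)
  qed
  have inner: "emeasure N B = (SUP K\<in>{K. K \<subseteq> B \<and> compact K}. emeasure N K)" if B: "B \<in> sets M" for B
  proof (rule antisym)
    have K_sets: "K \<in> sets M" if "K \<subseteq> B" "compact K" for K
    proof -
      have "B \<subseteq> X" using B sets.sets_into_space[OF B] sets_eq_imp_space_eq[OF sM] by (simp add: space_restrict_space)
      then have "K = K \<inter> X" using that by auto
      moreover have "K \<in> sets borel" using that(2) by (intro borel_closed compact_imp_closed)
      ultimately show ?thesis unfolding sM sets_restrict_space by blast
    qed
    show "(SUP K\<in>{K. K \<subseteq> B \<and> compact K}. emeasure N K) \<le> emeasure N B"
      using B sN by (intro SUP_least emeasure_mono) auto
    show "emeasure N B \<le> (SUP K\<in>{K. K \<subseteq> B \<and> compact K}. emeasure N K)"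
    proof (rule ennreal_le_epsilon)
      fix e :: real assume "0 < e"
      have SB: "emeasure M B = (SUP K\<in>{K. K \<subseteq> B \<and> compact K}. emeasure M K)"
        using reg B unfolding regular_borel_on_def by blast
      have ne: "{K. K \<subseteq> B \<and> compact K} \<noteq> {}" using compact_empty by blast
      obtain K where K: "K \<subseteq> B" "compact K" "emeasure M B < emeasure M K + ennreal (e / C)"
        using SUP_approx_ennreal[OF _ ne SB, of "e / C"] \<open>0 < e\<close> \<open>0 < C\<close> M_fin[of B] by auto
      have "emeasure N B \<le> emeasure N K + ennreal e"
        using approx[OF K_sets[OF K(1,2)] B K(1,3) \<open>0 < e\<close>] .
      also have "emeasure N K \<le> (SUP K\<in>{K. K \<subseteq> B \<and> compact K}. emeasure N K)"
        using K by (intro SUP_upper) auto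
      finally show "emeasure N B \<le> (SUP K\<in>{K. K \<subseteq> B \<and> compact K}. emeasure N K) + ennreal e"
        by (simp add: add_right_mono)
    qed
  qed
  have outer: "emeasure N B = (INF U\<in>{U. B \<subseteq> U \<and> openin (top_of_set X) U}. emeasure N U)"
    if B: "B \<in> sets M" for B
  proof (rule antisym)
    have U_sets: "U \<in> sets M" if "openin (top_of_set X) U" for U
      using openin_in_sets_restrict_borel[OF sM that] .
    show "emeasure N B \<le> (INF U\<in>{U. B \<subseteq> U \<and> openin (top_of_set X) U}. emeasure N U)"
      using U_sets sN by (intro INF_greatest emeasure_mono) auto
    show "(INF U\<in>{U. B \<subseteq> U \<and> openin (top_of_set X) U}. emeasure N U) \<le> emeasure N B"
    proof (rule ennreal_le_epsilon)
      fix e :: real assume "0 < e"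
      have SB: "emeasure M B = (INF U\<in>{U. B \<subseteq> U \<and> openin (top_of_set X) U}. emeasure M U)"
        using reg B unfolding regular_borel_on_def by blast
      obtain U where U: "B \<subseteq> U" "openin (top_of_set X) U" "emeasure M U < emeasure M B + ennreal (e / C)"
        using INF_approx_ennreal[OF _ SB, of "e / C"] \<open>0 < e\<close> \<open>0 < C\<close> M_fin[of B] by auto
      have "(INF U\<in>{U. B \<subseteq> U \<and> openin (top_of_set X) U}. emeasure N U) \<le> emeasure N U"
        using U by (intro INF_lower) auto
      also have "\<dots> \<le> emeasure N B + ennreal e"
        using approx[OF B U_sets[OF U(2)] U(1,3) \<open>0 < e\<close>] .
      finally show "(INF U\<in>{U. B \<subseteq> U \<and> openin (top_of_set X) U}. emeasure N U) \<le> emeasure N B + ennreal e" .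
    qed
  qed
  show ?thesis
    using inner outer sN sM unfolding regular_borel_on_def N_def[symmetric] by simp
qed

lemma supp_on_subset: "supp_on X M \<subseteq> X"
  by (auto simp: supp_on_def)

lemma openin_null_disjoint_supp_on:
  assumes "openin (top_of_set X) U" "emeasure M U = 0"
  shows "U \<inter> supp_on X M = {}"
  using assms unfolding supp_on_def by blast

text \<open>The complement of the support is a union of possibly uncountably many null open sets; by
  Lindelof countably many of them already cover it.\<close>

lemma AE_in_supp_on:
  fixes M :: "'a::second_countable_topology measure"
  assumes sM: "sets M = sets (restrict_space borel X)"
  shows "AE x in M. x \<in> supp_on X M"
proof -
  define \<U> where "\<U> = {U. openin (top_of_set X) U \<and> emeasure M U = 0}"
  obtain \<V> where V: "\<V> \<subseteq> \<U>" "countable \<V>" "\<Union>\<V> = \<Union>\<U>"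
    using Lindelof_openin[of \<U> X] unfolding \<U>_def by blast
  have sets: "U \<in> sets M" if "U \<in> \<U>" for U
    using openin_in_sets_restrict_borel[OF sM] that by (simp add: \<U>_def)
  have "(\<Union>V\<in>\<V>. V) \<in> null_sets M"
    using V sets by (intro null_sets_UN') (auto simp: \<U>_def null_sets_def)
  moreover have "space M = X" using sets_eq_imp_space_eq[OF sM] by (simp add: space_restrict_space)
  ultimately show ?thesis
    using V(3) by (intro AE_I'[of "\<Union>\<U>"]) (auto simp: supp_on_def \<U>_def)
qed

text \<open>The complement of \<open>C\<close> is relatively open and null, hence misses the
  support. Closed conditions that hold almost everywhere thus become pointwise conditions on the
  support.\<close>

lemma closedin_contains_supp_on:
  assumes sM: "sets M = sets (restrict_space borel X)"
    and C: "closedin (top_of_set X) C" and AE: "AE x in M. x \<in> C"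
  shows "supp_on X M \<subseteq> C"
proof -
  have spM: "space M = X" using sets_eq_imp_space_eq[OF sM] by (simp add: space_restrict_space)
  have o: "openin (top_of_set X) (X - C)" using C by (simp add: closedin_def)
  then have "X - C \<in> sets M" by (rule openin_in_sets_restrict_borel[OF sM])
  then have "emeasure M (X - C) = 0"
    using AE by (intro AE_iff_measurable[THEN iffD1, of _ _ "\<lambda>x. x \<in> C"]) (auto simp: spM)
  with openin_null_disjoint_supp_on[OF o] show ?thesis
    using supp_on_subset[of X M] by blast
qed

text \<open>For small \<open>t\<close> the linear term dominates, and it changes sign with
  \<open>t\<close>. This is applied to the quadratic form of the action along lines of
  functions.\<close>

lemma linear_quadratic_nonneg:
  fixes \<beta> \<gamma> \<delta> :: real
  assumes "0 < \<delta>" and nonneg: "\<And>t. \<bar>t\<bar> \<le> \<delta> \<Longrightarrow> 0 \<le> t * \<beta> + t\<^sup>2 * \<gamma>"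
  shows "\<beta> = 0" and "0 \<le> \<gamma>"
proof -
  show "\<beta> = 0"
  proof (rule ccontr)
    assume "\<beta> \<noteq> 0"
    \<comment> \<open>This size makes the quadratic term at most half of the linear one, and the
      sign of \<open>t\<close> below makes the linear term negative. The \<open>+ 1\<close> keeps
      the denominator positive.\<close>
    define s where "s = min \<delta> (\<bar>\<beta>\<bar> / (2 * (\<bar>\<gamma>\<bar> + 1)))"
    have s: "0 < s" "s \<le> \<delta>" "s \<le> \<bar>\<beta>\<bar> / (2 * (\<bar>\<gamma>\<bar> + 1))"
      using \<open>0 < \<delta>\<close> \<open>\<beta> \<noteq> 0\<close> by (auto simp: s_def)
    have "s * (2 * (\<bar>\<gamma>\<bar> + 1)) \<le> \<bar>\<beta>\<bar>"
      using s(3) by (subst (asm) pos_le_divide_eq) auto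
    then have s3: "s * (\<bar>\<gamma>\<bar> + 1) \<le> \<bar>\<beta>\<bar> / 2" by (simp add: algebra_simps)
    define t where "t = - sgn \<beta> * s"
    have "0 \<le> t * \<beta> + t\<^sup>2 * \<gamma>"
      using s by (intro nonneg) (auto simp: t_def abs_mult abs_sgn_eq)
    also have "\<dots> = s * (s * \<gamma> - \<bar>\<beta>\<bar>)"
      using \<open>\<beta> \<noteq> 0\<close> by (simp add: t_def power2_eq_square sgn_if algebra_simps)
    finally have "\<bar>\<beta>\<bar> \<le> s * \<gamma>" using s(1) by (simp add: zero_le_mult_iff)
    also have "\<dots> \<le> s * (\<bar>\<gamma>\<bar> + 1)" using s(1) by (intro mult_left_mono) auto
    finally show False using s3 \<open>\<beta> \<noteq> 0\<close> by simp
  qed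
  with nonneg[of \<delta>] \<open>0 < \<delta>\<close> show "0 \<le> \<gamma>" by (simp add: zero_le_mult_iff)
qed

section \<open>Minimizers for kernels of finite rank\<close>

text \<open>The kernel has finite rank, as \<open>a\<close> and \<open>b\<close> take values in a
  Euclidean space. The bounds stand in for compactness of \<open>X\<close>, and
  \<open>identity\<close> stands in for analyticity together with connectedness.\<close>

locale causal_minimizer = prob_space \<rho>
  for \<rho> :: "'x::{metric_space,second_countable_topology} measure" +
  fixes X :: "'x set" and a b :: "'x \<Rightarrow> 'e::euclidean_space"
  assumes regular: "regular_borel_on X \<rho>"
    and cont_a: "continuous_on X a" and cont_b: "continuous_on X b"
    and bounded_a: "bounded (a ` X)" and bounded_b: "bounded (b ` X)"
    and sym: "x \<in> X \<Longrightarrow> y \<in> X \<Longrightarrow> a x \<bullet> b y = a y \<bullet> b x"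
    and diag_pos: "x \<in> X \<Longrightarrow> 0 < a x \<bullet> b x"
    and identity: "openin (top_of_set X) U \<Longrightarrow> U \<noteq> {} \<Longrightarrow> (\<And>y. y \<in> U \<Longrightarrow> w \<bullet> b y = c) \<Longrightarrow>
      y \<in> X \<Longrightarrow> w \<bullet> b y = c"
    and minimal: "regular_borel_on X \<sigma> \<Longrightarrow> prob_space \<sigma> \<Longrightarrow>
      (\<integral>p. max 0 (a (fst p) \<bullet> b (snd p)) \<partial>(\<rho> \<Otimes>\<^sub>M \<rho>)) \<le>
      (\<integral>p. max 0 (a (fst p) \<bullet> b (snd p)) \<partial>(\<sigma> \<Otimes>\<^sub>M \<sigma>))"
begin

section \<open>The Lagrangian and bounded measurable functions\<close>

definition L :: "'x \<Rightarrow> 'x \<Rightarrow> real" where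
  "L x y = max 0 (a x \<bullet> b y)"

text \<open>The class of test functions: all are integrable because \<open>\<rho>\<close> is a
  probability measure on \<open>X\<close>, and the class is stable under the products and the
  integral operator used below.\<close>

definition bounded_meas :: "('x \<Rightarrow> 'c::{banach,second_countable_topology}) \<Rightarrow> bool" where
  "bounded_meas f \<longleftrightarrow> f \<in> borel_measurable \<rho> \<and> bounded (f ` X)"

abbreviation supp :: "'x set" where
  "supp \<equiv> supp_on X \<rho>"

lemma sets_rho: "sets \<rho> = sets (restrict_space borel X)"
  using regular by (simp add: regular_borel_on_def)

lemma space_rho [simp]: "space \<rho> = X"
  using sets_eq_imp_space_eq[OF sets_rho] by (simp add: space_restrict_space)

lemma prob_X [simp]: "prob X = 1"
  using prob_space by simp

lemma supp_subset: "supp \<subseteq> X"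
  by (rule supp_on_subset)

lemma AE_supp: "AE x in \<rho>. x \<in> supp"
  by (rule AE_in_supp_on[OF sets_rho])

lemma L_nonneg: "0 \<le> L x y"
  by (simp add: L_def)

lemma L_sym: "x \<in> X \<Longrightarrow> y \<in> X \<Longrightarrow> L x y = L y x"
  by (simp add: L_def sym)

lemma borel_measurable_rho:
  assumes "continuous_on X f"
  shows "f \<in> borel_measurable \<rho>"
  using borel_measurable_continuous_on_restrict[OF assms]
  by (simp add: measurable_cong_sets[OF sets_rho refl])

lemma measurable_a [measurable]: "a \<in> borel_measurable \<rho>"
  and measurable_b [measurable]: "b \<in> borel_measurable \<rho>"
  by (rule borel_measurable_rho[OF cont_a], rule borel_measurable_rho[OF cont_b])

lemma L_bounded: obtains C where "0 < C" "\<And>x y. x \<in> X \<Longrightarrow> y \<in> X \<Longrightarrow> \<bar>L x y\<bar> \<le> C"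
proof -
  obtain A B where A: "0 < A" "\<And>x. x \<in> X \<Longrightarrow> norm (a x) \<le> A"
    and B: "0 < B" "\<And>x. x \<in> X \<Longrightarrow> norm (b x) \<le> B"
    using bounded_a bounded_b unfolding bounded_pos by auto
  have "\<bar>L x y\<bar> \<le> A * B" if "x \<in> X" "y \<in> X" for x y
  proof -
    have "\<bar>L x y\<bar> \<le> \<bar>a x \<bullet> b y\<bar>" by (simp add: L_def)
    also have "\<dots> \<le> norm (a x) * norm (b y)" by (rule Cauchy_Schwarz_ineq2)
    also have "\<dots> \<le> A * B" using A B that by (intro mult_mono) auto
    finally show ?thesis .
  qed
  then show ?thesis using that[of "A * B"] A B by simp
qed

lemma bounded_measI:
  assumes "f \<in> borel_measurable \<rho>" "\<And>x. x \<in> X \<Longrightarrow> norm (f x) \<le> C"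
  shows "bounded_meas f"
  using assms unfolding bounded_meas_def bounded_iff by auto

lemma bounded_measE:
  assumes "bounded_meas f"
  obtains C where "0 < C" "\<And>x. x \<in> X \<Longrightarrow> norm (f x) \<le> C"
  using assms unfolding bounded_meas_def bounded_pos by auto

lemma bounded_meas_measurable: "bounded_meas f \<Longrightarrow> f \<in> borel_measurable \<rho>"
  by (simp add: bounded_meas_def)

lemma bounded_meas_integrable:
  assumes "bounded_meas f"
  shows "integrable \<rho> f"
proof -
  obtain C where "\<And>x. x \<in> X \<Longrightarrow> norm (f x) \<le> C" by (rule bounded_measE[OF assms]) blast
  then show ?thesis
    using bounded_meas_measurable[OF assms]
    by (intro integrable_const_bound[of _ C]) auto
qed

lemma bounded_meas_const: "bounded_meas (\<lambda>x. c)"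
  by (rule bounded_measI[of _ "norm c"]) auto

lemma bounded_meas_add:
  assumes "bounded_meas f" "bounded_meas g"
  shows "bounded_meas (\<lambda>x. f x + g x)"
  using assms by (auto simp: bounded_meas_def intro: bounded_plus_comp)

text \<open>One argument serves products, scalar multiples and inner products alike.\<close>

lemma bounded_meas_bilinear:
  assumes "bounded_bilinear B" "bounded_meas f" "bounded_meas g"
  shows "bounded_meas (\<lambda>x. B (f x) (g x))"
proof -
  interpret bounded_bilinear B by fact
  obtain F where F: "0 < F" "\<And>x. x \<in> X \<Longrightarrow> norm (f x) \<le> F" by (rule bounded_measE[OF assms(2)]) blast
  obtain G where G: "0 < G" "\<And>x. x \<in> X \<Longrightarrow> norm (g x) \<le> G" by (rule bounded_measE[OF assms(3)]) blast
  obtain K where K: "0 \<le> K" "\<And>x y. norm (B x y) \<le> norm x * norm y * K" using nonneg_bounded by blast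
  have "(\<lambda>x. B (f x) (g x)) \<in> borel_measurable \<rho>"
    using bounded_meas_measurable[OF assms(2)] bounded_meas_measurable[OF assms(3)]
    by (intro borel_measurable_continuous_Pair[where H="B"])
       (auto intro!: continuous_intros bounded_bilinear.continuous_on[OF assms(1)])
  moreover have "norm (B (f x) (g x)) \<le> F * G * K" if "x \<in> X" for x
  proof -
    have "norm (f x) * norm (g x) * K \<le> F * G * K"
      using F G K that by (intro mult_right_mono mult_mono) (auto intro: less_imp_le)
    with K(2) show ?thesis by (rule order_trans)
  qed
  ultimately show ?thesis by (rule bounded_measI)
qed

lemmas bounded_meas_mult = bounded_meas_bilinear[OF bounded_bilinear_mult]
  and bounded_meas_scaleR = bounded_meas_bilinear[OF bounded_bilinear_scaleR]
  and bounded_meas_inner = bounded_meas_bilinear[OF bounded_bilinear_inner]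

lemma bounded_meas_minus:
  fixes f g :: "'x \<Rightarrow> real"
  assumes "bounded_meas f" "bounded_meas g"
  shows "bounded_meas (\<lambda>x. f x - g x)"
  using bounded_meas_add[OF assms(1) bounded_meas_mult[OF bounded_meas_const[of "-1"] assms(2)]] by simp

lemma bounded_meas_indicator: "A \<in> sets \<rho> \<Longrightarrow> bounded_meas (indicator A :: 'x \<Rightarrow> real)"
  by (rule bounded_measI[of _ 1]) (auto simp: indicator_def)

lemma bounded_meas_a: "bounded_meas a" and bounded_meas_b: "bounded_meas b"
  using bounded_a bounded_b by (auto simp: bounded_meas_def)

lemma L_measurable_pair [measurable]:
  "(\<lambda>p. L (fst p) (snd p)) \<in> borel_measurable (\<rho> \<Otimes>\<^sub>M \<rho>)"
  unfolding L_def by measurable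

lemma bounded_meas_L: "x \<in> X \<Longrightarrow> bounded_meas (L x)"
proof -
  assume x: "x \<in> X"
  obtain C where "\<And>x y. x \<in> X \<Longrightarrow> y \<in> X \<Longrightarrow> \<bar>L x y\<bar> \<le> C" by (rule L_bounded) blast
  moreover have "L x \<in> borel_measurable \<rho>" unfolding L_def by measurable
  ultimately show ?thesis using x by (intro bounded_measI[of _ C]) auto
qed

lemma cont_L: "y \<in> X \<Longrightarrow> continuous_on X (\<lambda>x. L x y)" "continuous_on X (L x)"
  unfolding L_def by (intro continuous_intros cont_a cont_b)+

section \<open>The integral operator with kernel \<open>L\<close> and its quadratic form\<close>

definition pot :: "('x \<Rightarrow> real) \<Rightarrow> 'x \<Rightarrow> real" where
  "pot f x = (\<integral>y. L x y * f y \<partial>\<rho>)"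

sublocale pair: pair_prob_space \<rho> \<rho> ..

lemma integrable_pair:
  assumes f: "bounded_meas f" and g: "bounded_meas g"
  shows "integrable (\<rho> \<Otimes>\<^sub>M \<rho>) (\<lambda>p. f (fst p) * (L (fst p) (snd p) * g (snd p)))"
proof -
  note [measurable] = bounded_meas_measurable[OF f] bounded_meas_measurable[OF g]
  obtain F where F: "0 < F" "\<And>x. x \<in> X \<Longrightarrow> norm (f x) \<le> F" by (rule bounded_measE[OF f]) blast
  obtain G where G: "0 < G" "\<And>x. x \<in> X \<Longrightarrow> norm (g x) \<le> G" by (rule bounded_measE[OF g]) blast
  obtain C where C: "0 < C" "\<And>x y. x \<in> X \<Longrightarrow> y \<in> X \<Longrightarrow> \<bar>L x y\<bar> \<le> C" by (rule L_bounded) blast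
  have "norm (f (fst p) * (L (fst p) (snd p) * g (snd p))) \<le> F * (C * G)"
    if "p \<in> space (\<rho> \<Otimes>\<^sub>M \<rho>)" for p
    using that F G C unfolding norm_mult space_pair_measure
    by (intro mult_mono) auto
  then show ?thesis
    by (intro pair.integrable_const_bound[of _ "F * (C * G)"]) auto
qed

lemma integral_pot:
  assumes f: "bounded_meas f" and g: "bounded_meas g"
  shows "(\<integral>x. f x * pot g x \<partial>\<rho>) = (\<integral>p. f (fst p) * (L (fst p) (snd p) * g (snd p)) \<partial>(\<rho> \<Otimes>\<^sub>M \<rho>))"
  using pair.integral_fst'[OF integrable_pair[OF f g]] by (simp add: pot_def)

lemma bounded_meas_pot:
  assumes f: "bounded_meas f"
  shows "bounded_meas (pot f)"
proof -
  note [measurable] = bounded_meas_measurable[OF f]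
  obtain F where F: "0 < F" "\<And>x. x \<in> X \<Longrightarrow> norm (f x) \<le> F" by (rule bounded_measE[OF f]) blast
  obtain C where C: "0 < C" "\<And>x y. x \<in> X \<Longrightarrow> y \<in> X \<Longrightarrow> \<bar>L x y\<bar> \<le> C" by (rule L_bounded) blast
  have "(\<lambda>(x, y). L x y * f y) \<in> borel_measurable (\<rho> \<Otimes>\<^sub>M \<rho>)"
    unfolding L_def by measurable
  then have "pot f \<in> borel_measurable \<rho>"
    unfolding pot_def by (rule borel_measurable_lebesgue_integral)
  moreover have "norm (pot f x) \<le> C * F" if x: "x \<in> X" for x
  proof -
    have int: "integrable \<rho> (\<lambda>y. L x y * f y)"
      by (intro bounded_meas_integrable bounded_meas_mult bounded_meas_L x f)
    have "norm (pot f x) \<le> (\<integral>y. norm (L x y * f y) \<partial>\<rho>)"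
      unfolding pot_def by (rule integral_norm_bound)
    also have "\<dots> \<le> (\<integral>y. C * F \<partial>\<rho>)"
      using int F C x by (intro integral_mono integrable_norm) (auto simp: abs_mult intro!: mult_mono)
    also have "\<dots> = C * F" by (simp add: prob_space)
    finally show ?thesis .
  qed
  ultimately show ?thesis by (rule bounded_measI)
qed

text \<open>Self-adjointness of the operator: swap the variables by Fubini and use the symmetry of
  \<open>L\<close>.\<close>

lemma pot_sym:
  assumes f: "bounded_meas f" and g: "bounded_meas g"
  shows "(\<integral>x. f x * pot g x \<partial>\<rho>) = (\<integral>x. g x * pot f x \<partial>\<rho>)"
proof -
  note [measurable] = bounded_meas_measurable[OF f] bounded_meas_measurable[OF g]
  have "(\<integral>x. f x * pot g x \<partial>\<rho>) = (\<integral>p. f (fst p) * (L (fst p) (snd p) * g (snd p)) \<partial>(\<rho> \<Otimes>\<^sub>M \<rho>))"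
    by (rule integral_pot[OF f g])
  also have "\<dots> = (\<integral>(x, y). f y * (L y x * g x) \<partial>(\<rho> \<Otimes>\<^sub>M \<rho>))"
    by (subst pair.integral_product_swap[symmetric])
       (auto simp: split_beta intro!: borel_measurable_integrable integrable_pair f g)
  also have "\<dots> = (\<integral>p. g (fst p) * (L (fst p) (snd p) * f (snd p)) \<partial>(\<rho> \<Otimes>\<^sub>M \<rho>))"
    by (intro Bochner_Integration.integral_cong) (auto simp: space_pair_measure L_sym)
  also have "\<dots> = (\<integral>x. g x * pot f x \<partial>\<rho>)"
    by (rule integral_pot[OF g f, symmetric])
  finally show ?thesis .
qed

lemma pot_add:
  assumes "bounded_meas f" "bounded_meas g" "x \<in> X"
  shows "pot (\<lambda>y. f y + s * g y) x = pot f x + s * pot g x"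
proof -
  have "pot (\<lambda>y. f y + s * g y) x = (\<integral>y. L x y * f y + s * (L x y * g y) \<partial>\<rho>)"
    unfolding pot_def by (simp add: algebra_simps)
  also have "\<dots> = pot f x + s * pot g x"
    unfolding pot_def using assms
    by (subst Bochner_Integration.integral_add)
       (auto intro!: bounded_meas_integrable bounded_meas_mult bounded_meas_L bounded_meas_const)
  finally show ?thesis .
qed

lemma quadratic_expand:
  assumes f: "bounded_meas f" and g: "bounded_meas g"
  shows "(\<integral>x. (f x + s * g x) * pot (\<lambda>y. f y + s * g y) x \<partial>\<rho>) =
    (\<integral>x. f x * pot f x \<partial>\<rho>) + 2 * s * (\<integral>x. g x * pot f x \<partial>\<rho>) + s\<^sup>2 * (\<integral>x. g x * pot g x \<partial>\<rho>)"
proof -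
  note int = bounded_meas_integrable[OF bounded_meas_mult[OF _ bounded_meas_pot]]
  have "(\<integral>x. (f x + s * g x) * pot (\<lambda>y. f y + s * g y) x \<partial>\<rho>) =
    (\<integral>x. f x * pot f x + s * (f x * pot g x) + s * (g x * pot f x) + s\<^sup>2 * (g x * pot g x) \<partial>\<rho>)"
    by (intro Bochner_Integration.integral_cong)
       (auto simp: pot_add[OF f g] algebra_simps power2_eq_square)
  also have "\<dots> = (\<integral>x. f x * pot f x \<partial>\<rho>) + s * (\<integral>x. f x * pot g x \<partial>\<rho>) + s * (\<integral>x. g x * pot f x \<partial>\<rho>)
      + s\<^sup>2 * (\<integral>x. g x * pot g x \<partial>\<rho>)"
    by (simp add: int f g)
  finally show ?thesis using pot_sym[OF f g] by simp
qed

text \<open>Dominated convergence along sequences. Continuity is what later upgrades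
  almost-everywhere identities for \<open>pot f\<close> to identities at every point of the
  support.\<close>

lemma cont_pot:
  assumes f: "bounded_meas f"
  shows "continuous_on X (pot f)"
  unfolding continuous_on_sequentially
proof (intro allI ballI impI, elim conjE)
  fix s :: "nat \<Rightarrow> 'x" and x assume x: "x \<in> X" and s: "\<forall>n. s n \<in> X" "s \<longlonglongrightarrow> x"
  note [measurable] = bounded_meas_measurable[OF f]
  obtain F where F: "0 < F" "\<And>x. x \<in> X \<Longrightarrow> norm (f x) \<le> F" by (rule bounded_measE[OF f]) blast
  obtain C where C: "0 < C" "\<And>x y. x \<in> X \<Longrightarrow> y \<in> X \<Longrightarrow> \<bar>L x y\<bar> \<le> C" by (rule L_bounded) blast
  have "(\<lambda>n. L (s n) y * f y) \<longlonglongrightarrow> L x y * f y" if "y \<in> X" for y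
    using cont_L(1)[OF that] x s unfolding continuous_on_sequentially comp_def
    by (intro tendsto_mult tendsto_const) auto
  moreover have "(\<lambda>y. L x y * f y) \<in> borel_measurable \<rho>" for x
    unfolding L_def by measurable
  ultimately show "(pot f \<circ> s) \<longlonglongrightarrow> pot f x"
    unfolding comp_def pot_def using s C F
    by (intro integral_dominated_convergence[where w="\<lambda>_. C * F"])
       (auto simp: abs_mult intro!: mult_mono)
qed

text \<open>The complement of \<open>U\<close> together with the zeros of \<open>f\<close> is a
  relatively closed set of full measure, so it contains the support.\<close>

lemma continuous_AE_zero:
  fixes f :: "'x \<Rightarrow> real"
  assumes "continuous_on X f" "openin (top_of_set X) U" "AE x in \<rho>. x \<in> U \<longrightarrow> f x = 0" "x \<in> U" "x \<in> supp"
  shows "f x = 0"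
proof -
  have "closedin (top_of_set X) {x \<in> X. f x = 0}"
    using continuous_closedin_preimage_constant[OF assms(1)] .
  then have "closedin (top_of_set X) ((X - U) \<union> {x \<in> X. f x = 0})"
    using assms(2) by (intro closedin_Un closedin_diff) auto
  moreover have "AE x in \<rho>. x \<in> (X - U) \<union> {x \<in> X. f x = 0}"
    using assms(3) AE_space by eventually_elim auto
  ultimately have "supp \<subseteq> (X - U) \<union> {x \<in> X. f x = 0}"
    by (rule closedin_contains_supp_on[OF sets_rho])
  then show ?thesis using assms(4,5) by auto
qed


section \<open>First and second variation of the action\<close>

lemma variation:
  assumes h: "bounded_meas h" and nonneg: "\<And>x. x \<in> X \<Longrightarrow> 0 \<le> h x" and one: "(\<integral>x. h x \<partial>\<rho>) = 1"
  shows "(\<integral>x. pot (\<lambda>_. 1) x \<partial>\<rho>) \<le> (\<integral>x. h x * pot h x \<partial>\<rho>)"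
proof -
  note h_meas [measurable] = bounded_meas_measurable[OF h]
  obtain C where C: "0 < C" "\<And>x. x \<in> X \<Longrightarrow> norm (h x) \<le> C" by (rule bounded_measE[OF h]) blast
  \<comment> \<open>The competitor with density \<open>h\<close>: in its action one factor
    \<open>h\<close> appears for each variable, so the action is the quadratic form of
    \<open>h\<close>.\<close>
  define \<sigma> where "\<sigma> = density \<rho> (\<lambda>x. ennreal (h x))"
  have reg: "regular_borel_on X \<sigma>"
    unfolding \<sigma>_def using C
    by (intro regular_borel_on_density[OF regular _ h_meas, of C] finite_measure_axioms)
       (auto dest: C(2) simp: abs_le_iff)
  have "emeasure \<sigma> (space \<sigma>) = (\<integral>\<^sup>+x. ennreal (h x) \<partial>\<rho>)"
    unfolding \<sigma>_def
    by (subst emeasure_density) (auto intro!: nn_integral_cong simp: indicator_def simp flip: space_rho)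
  also have "\<dots> = 1"
    using one nonneg bounded_meas_integrable[OF h] by (subst nn_integral_eq_integral) auto
  finally have prob: "prob_space \<sigma>" by (rule prob_spaceI)
  interpret S: prob_space \<sigma> by (rule prob)
  have "(\<integral>x. pot (\<lambda>_. 1) x \<partial>\<rho>) = (\<integral>p. L (fst p) (snd p) \<partial>(\<rho> \<Otimes>\<^sub>M \<rho>))"
    using integral_pot[OF bounded_meas_const bounded_meas_const, of 1 1] by simp
  also have "\<dots> \<le> (\<integral>p. L (fst p) (snd p) \<partial>(\<sigma> \<Otimes>\<^sub>M \<sigma>))"
    unfolding L_def by (rule minimal[OF reg prob])
  also have "\<sigma> \<Otimes>\<^sub>M \<sigma> = density (\<rho> \<Otimes>\<^sub>M \<rho>) (\<lambda>(x, y). ennreal (h x) * ennreal (h y))"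
    unfolding \<sigma>_def
    by (rule pair_measure_density) (auto simp: \<sigma>_def[symmetric] S.sigma_finite_measure_axioms sigma_finite_measure_axioms)
  also have "\<dots> = density (\<rho> \<Otimes>\<^sub>M \<rho>) (\<lambda>p. ennreal (h (fst p) * h (snd p)))"
    by (intro density_cong) (auto simp: space_pair_measure nonneg ennreal_mult intro!: AE_I2)
  also have "(\<integral>p. L (fst p) (snd p) \<partial>\<dots>) =
      (\<integral>p. (h (fst p) * h (snd p)) *\<^sub>R L (fst p) (snd p) \<partial>(\<rho> \<Otimes>\<^sub>M \<rho>))"
    by (intro integral_density) (auto simp: space_pair_measure nonneg intro!: AE_I2)
  also have "\<dots> = (\<integral>x. h x * pot h x \<partial>\<rho>)"
    by (subst integral_pot[OF h h]) (simp add: mult_ac)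
  finally show ?thesis .
qed

text \<open>By \<open>integral_pot\<close> this is the action of \<open>\<rho>\<close>.\<close>

abbreviation "S \<equiv> (\<integral>x. pot (\<lambda>_. 1) x \<partial>\<rho>)"

text \<open>Zero mean preserves total mass one, so \<open>1 + t * f\<close> is a probability density
  for all small \<open>t\<close> of either sign. Hence the first variation vanishes and the second
  is nonnegative.\<close>

lemma mean_zero_variation:
  assumes f: "bounded_meas f" and zero: "(\<integral>x. f x \<partial>\<rho>) = 0"
  shows "(\<integral>x. f x * pot (\<lambda>_. 1) x \<partial>\<rho>) = 0" and "0 \<le> (\<integral>x. f x * pot f x \<partial>\<rho>)"
proof -
  obtain C where C: "0 < C" "\<And>x. x \<in> X \<Longrightarrow> norm (f x) \<le> C" by (rule bounded_measE[OF f]) blast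
  have "0 \<le> t * (2 * (\<integral>x. f x * pot (\<lambda>_. 1) x \<partial>\<rho>)) + t\<^sup>2 * (\<integral>x. f x * pot f x \<partial>\<rho>)"
    if t: "\<bar>t\<bar> \<le> 1 / C" for t
  proof -
    have "\<bar>t * f x\<bar> \<le> 1" if "x \<in> X" for x
    proof -
      have "\<bar>t * f x\<bar> \<le> 1 / C * C" unfolding abs_mult using t C that by (intro mult_mono) auto
      then show ?thesis using C(1) by simp
    qed
    then have nonneg: "0 \<le> 1 + t * f x" if "x \<in> X" for x using that by (force simp: abs_le_iff)
    have h: "bounded_meas (\<lambda>x. 1 + t * f x)"
      by (intro bounded_meas_add bounded_meas_mult bounded_meas_const f)
    have "(\<integral>x. 1 + t * f x \<partial>\<rho>) = 1"
      using bounded_meas_integrable[OF f] zero by simp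
    from variation[OF h nonneg this] show ?thesis
      using quadratic_expand[OF bounded_meas_const[of 1] f, of t] by (simp add: algebra_simps)
  qed
  from linear_quadratic_nonneg[OF divide_pos_pos[OF zero_less_one C(1)] this]
  show "(\<integral>x. f x * pot (\<lambda>_. 1) x \<partial>\<rho>) = 0" "0 \<le> (\<integral>x. f x * pot f x \<partial>\<rho>)" by simp_all
qed

text \<open>The Euler-Lagrange equation. The deviation of the potential from its mean is itself a
  direction of zero mean; testing the first variation with it shows that its square integrates to
  zero.\<close>

lemma pot_one_on_supp:
  assumes "x \<in> supp"
  shows "pot (\<lambda>_. 1) x = S"
proof -
  define f where "f = (\<lambda>x. pot (\<lambda>_. 1) x - S)"
  have p: "bounded_meas (pot (\<lambda>_. 1))" by (intro bounded_meas_pot bounded_meas_const)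
  have f: "bounded_meas f" unfolding f_def by (intro bounded_meas_minus p bounded_meas_const)
  have zero: "(\<integral>x. f x \<partial>\<rho>) = 0" unfolding f_def using bounded_meas_integrable[OF p] by simp
  have "(\<integral>x. f x * f x \<partial>\<rho>) = (\<integral>x. f x * pot (\<lambda>_. 1) x - S * f x \<partial>\<rho>)"
    by (simp add: f_def algebra_simps)
  also have "\<dots> = 0"
    using mean_zero_variation(1)[OF f zero] zero bounded_meas_integrable[OF f]
      bounded_meas_integrable[OF bounded_meas_mult[OF f p]] by simp
  finally have "AE x in \<rho>. f x * f x = 0"
    using integral_nonneg_eq_0_iff_AE[OF bounded_meas_integrable[OF bounded_meas_mult[OF f f]]] by simp
  then have "AE x in \<rho>. x \<in> X \<longrightarrow> f x = 0" by eventually_elim simp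
  moreover have "continuous_on X f"
    unfolding f_def by (intro continuous_intros cont_pot bounded_meas_const)
  ultimately have "f x = 0"
    using assms supp_subset by (intro continuous_AE_zero[of f X]) auto
  then show ?thesis by (simp add: f_def)
qed

text \<open>Removes the zero-mean restriction: after splitting off the mean \<open>m\<close>, the
  cross term vanishes by the first variation, and the constant part contributes
  \<open>m\<^sup>2 * S\<close>, which is nonnegative because \<open>L\<close> is.\<close>

lemma quadratic_nonneg:
  assumes f: "bounded_meas f"
  shows "0 \<le> (\<integral>x. f x * pot f x \<partial>\<rho>)"
proof -
  define m where "m = (\<integral>x. f x \<partial>\<rho>)"
  define g where "g = (\<lambda>x. f x - m)"
  have one: "bounded_meas (\<lambda>_. 1::real)" by (rule bounded_meas_const)
  have g: "bounded_meas g" unfolding g_def by (intro bounded_meas_minus f bounded_meas_const)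
  have zero: "(\<integral>x. g x \<partial>\<rho>) = 0" unfolding g_def m_def using bounded_meas_integrable[OF f] by simp
  have "f = (\<lambda>x. g x + m * 1)" by (simp add: g_def)
  then have "(\<integral>x. f x * pot f x \<partial>\<rho>) = (\<integral>x. g x * pot g x \<partial>\<rho>) + 2 * m * (\<integral>x. 1 * pot g x \<partial>\<rho>) + m\<^sup>2 * (\<integral>x. 1 * pot (\<lambda>_. 1) x \<partial>\<rho>)"
    using quadratic_expand[OF g one, of m] by simp
  moreover have "(\<integral>x. 1 * pot g x \<partial>\<rho>) = 0"
    using pot_sym[OF one g] mean_zero_variation(1)[OF g zero] by simp
  moreover have "0 \<le> S"
    unfolding pot_def by (intro integral_nonneg_AE AE_I2) (simp add: L_nonneg)
  ultimately show ?thesis using mean_zero_variation(2)[OF g zero] by simp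
qed

text \<open>The Cauchy-Schwarz argument for a positive semidefinite form: a null vector lies in the
  kernel of the operator. Along the direction \<open>pot f\<close> the linear coefficient is twice
  the squared norm of \<open>pot f\<close>, so that norm is zero.\<close>

lemma pot_null:
  assumes f: "bounded_meas f" and zero: "(\<integral>x. f x * pot f x \<partial>\<rho>) = 0" and x: "x \<in> supp"
  shows "pot f x = 0"
proof -
  note p = bounded_meas_pot[OF f]
  have "0 \<le> s * (2 * (\<integral>x. pot f x * pot f x \<partial>\<rho>)) + s\<^sup>2 * (\<integral>x. pot f x * pot (pot f) x \<partial>\<rho>)" for s
    using quadratic_nonneg[OF bounded_meas_add[OF f bounded_meas_mult[OF bounded_meas_const p]], of s]
    unfolding quadratic_expand[OF f p] by (simp add: zero algebra_simps)
  from linear_quadratic_nonneg(1)[OF zero_less_one this]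
  have "AE x in \<rho>. pot f x * pot f x = 0"
    using integral_nonneg_eq_0_iff_AE[OF bounded_meas_integrable[OF bounded_meas_mult[OF p p]]] by simp
  then have "AE x in \<rho>. x \<in> X \<longrightarrow> pot f x = 0" by eventually_elim simp
  then show ?thesis
    using x supp_subset by (intro continuous_AE_zero[of "pot f" X] cont_pot f) auto
qed

text \<open>Let \<open>f\<close> be the residual on \<open>W\<close> of projecting
  \<open>L x\<close> onto the span of the components of \<open>b\<close>. On \<open>W\<close> the
  kernel \<open>L\<close> agrees with the bilinear pairing, so orthogonality to these components
  makes \<open>f\<close> a null vector and \<open>pot f x = 0\<close>. Thus \<open>f\<close> is
  orthogonal to \<open>L x\<close> as well as to its projection, which forces \<open>f\<close> to
  have norm zero.\<close>

lemma L_represented: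
  assumes W: "openin (top_of_set X) W" "W \<subseteq> supp"
    and pos: "\<And>x y. x \<in> W \<Longrightarrow> y \<in> W \<Longrightarrow> 0 \<le> a x \<bullet> b y" and x: "x \<in> supp"
  obtains w where "\<And>y. y \<in> W \<Longrightarrow> L x y = w \<bullet> b y"
proof -
  have xX: "x \<in> X" using x supp_subset by auto
  have WX: "W \<subseteq> X" using W(2) supp_subset by auto
  define i :: "'x \<Rightarrow> real" where "i = indicator W"
  have bi: "bounded_meas i"
    unfolding i_def by (intro bounded_meas_indicator openin_in_sets_restrict_borel[OF sets_rho W(1)])
  note closure = bounded_meas_integrable bounded_meas_mult bounded_meas_scaleR bounded_meas_inner
    bounded_meas_const bounded_meas_b bounded_meas_L bounded_meas_minus bi xX
  \<comment> \<open>\<open>M w = v\<close> are the normal equations for the orthogonal projection of \<open>L x\<close> in \<open>L\<^sup>2(W, \<rho>)\<close> onto the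
    span of the components of \<open>b\<close>; they are solvable as \<open>v\<close> is orthogonal to the kernel of \<open>M\<close>.\<close>
  define M where "M u = (\<integral>y. (i y * (u \<bullet> b y)) *\<^sub>R b y \<partial>\<rho>)" for u
  define v where "v = (\<integral>y. (i y * L x y) *\<^sub>R b y \<partial>\<rho>)"
  have inner_M: "r \<bullet> M u = (\<integral>y. i y * (u \<bullet> b y) * (r \<bullet> b y) \<partial>\<rho>)" for r u
    unfolding M_def by (subst integral_inner_right[symmetric]) (auto intro!: closure simp: mult_ac)
  have inner_v: "r \<bullet> v = (\<integral>y. i y * L x y * (r \<bullet> b y) \<partial>\<rho>)" for r
    unfolding v_def by (subst integral_inner_right[symmetric]) (auto intro!: closure simp: mult_ac)
  have lin: "linear M"
  proof (rule linearI)
    show "M (u1 + u2) = M u1 + M u2" for u1 u2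
      unfolding M_def inner_add_left distrib_left scaleR_add_left
      by (rule Bochner_Integration.integral_add) (auto intro!: closure)
    show "M (c *\<^sub>R u) = c *\<^sub>R M u" for c u
      unfolding M_def integral_scaleR_right[symmetric] by (simp add: mult_ac)
  qed
  obtain s r where sr: "s \<in> span (range M)" "\<And>w. w \<in> span (range M) \<Longrightarrow> orthogonal r w" "v = s + r"
    using orthogonal_subspace_decomp_exists[of "range M" v] by blast
  have span_eq: "span (range M) = range M"
    by (simp add: span_eq_iff linear_subspace_image[OF lin subspace_UNIV])
  obtain w where w: "s = M w" using sr(1) unfolding span_eq by auto
  \<comment> \<open>\<open>r \<bullet> M r\<close> is the squared norm of the function
    \<open>r \<bullet> b y\<close> on \<open>W\<close>, so this function vanishes almost everywhere
    there and \<open>r \<bullet> v = 0\<close>. With \<open>r \<bullet> s = 0\<close> and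
    \<open>v = s + r\<close> it follows that \<open>r = 0\<close>.\<close>
  have "0 = r \<bullet> M r" using sr(2)[of "M r"] unfolding span_eq orthogonal_def by auto
  also have "\<dots> = (\<integral>y. (i y * (r \<bullet> b y)) * (i y * (r \<bullet> b y)) \<partial>\<rho>)"
    unfolding inner_M by (intro Bochner_Integration.integral_cong) (auto simp: i_def indicator_def)
  finally have "AE y in \<rho>. (i y * (r \<bullet> b y)) * (i y * (r \<bullet> b y)) = 0"
    by (subst (asm) eq_commute, subst (asm) integral_nonneg_eq_0_iff_AE) (auto intro!: closure)
  then have ae: "AE y in \<rho>. i y * L x y * (r \<bullet> b y) = 0" by eventually_elim auto
  have "r \<bullet> v = 0"
    unfolding inner_v by (rule integral_eq_zero_AE[OF ae])
  moreover have "r \<bullet> s = 0" using sr(1,2) by (simp add: orthogonal_def)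
  ultimately have "v = M w" using sr(3) w by (simp add: inner_add_right)
  define f where "f y = i y * (L x y - w \<bullet> b y)" for y
  have f: "bounded_meas f" unfolding f_def by (intro closure)
  have fb: "(\<integral>y. f y *\<^sub>R b y \<partial>\<rho>) = 0"
  proof -
    have "(\<integral>y. f y *\<^sub>R b y \<partial>\<rho>) = (\<integral>y. (i y * L x y) *\<^sub>R b y - (i y * (w \<bullet> b y)) *\<^sub>R b y \<partial>\<rho>)"
      by (simp add: f_def algebra_simps)
    also have "\<dots> = v - M w"
      unfolding v_def M_def by (rule Bochner_Integration.integral_diff) (auto intro!: closure)
    finally show ?thesis using \<open>v = M w\<close> by simp
  qed
  have inner_f: "(\<integral>y. f y * (u \<bullet> b y) \<partial>\<rho>) = 0" for u
  proof -
    have "(\<integral>y. f y * (u \<bullet> b y) \<partial>\<rho>) = u \<bullet> (\<integral>y. f y *\<^sub>R b y \<partial>\<rho>)"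
      by (subst integral_inner_right[symmetric]) (auto intro!: closure f)
    then show ?thesis by (simp add: fb)
  qed
  have "f z * pot f z = 0" if z: "z \<in> X" for z
  proof (cases "z \<in> W")
    case True
    have "pot f z = (\<integral>y. f y * (a z \<bullet> b y) \<partial>\<rho>)"
      unfolding pot_def using pos[OF True]
      by (intro Bochner_Integration.integral_cong) (auto simp: f_def i_def indicator_def L_def)
    then show ?thesis by (simp add: inner_f)
  qed (simp add: f_def i_def)
  then have "(\<integral>z. f z * pot f z \<partial>\<rho>) = 0"
    by (intro integral_eq_zero_AE AE_I2) simp
  from pot_null[OF f this x] have pot0: "(\<integral>y. L x y * f y \<partial>\<rho>) = 0" by (simp add: pot_def)
  have "(\<integral>y. f y * f y \<partial>\<rho>) = (\<integral>y. L x y * f y - f y * (w \<bullet> b y) \<partial>\<rho>)"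
    by (intro Bochner_Integration.integral_cong) (auto simp: f_def i_def indicator_def algebra_simps)
  also have "\<dots> = 0"
    by (subst Bochner_Integration.integral_diff) (auto intro!: closure f simp: pot0 inner_f)
  finally have "AE y in \<rho>. f y * f y = 0"
    by (subst (asm) integral_nonneg_eq_0_iff_AE) (auto intro!: closure f)
  then have ae0: "AE y in \<rho>. y \<in> W \<longrightarrow> L x y - w \<bullet> b y = 0"
    by eventually_elim (auto simp: f_def i_def)
  have "L x y - w \<bullet> b y = 0" if "y \<in> W" for y
  proof (rule continuous_AE_zero[OF _ W(1) ae0 that])
    show "continuous_on X (\<lambda>y. L x y - w \<bullet> b y)" by (intro continuous_intros cont_L cont_b xX)
  qed (use that W in auto)
  then show ?thesis using that[of w] by simp
qed

section \<open>Consequences of a nonempty interior of the support\<close>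

theorem timelike_if_interior:
  assumes interior: "(top_of_set X) interior_of supp \<noteq> {}"
  shows "\<And>x y. x \<in> supp \<Longrightarrow> y \<in> supp \<Longrightarrow> 0 \<le> a x \<bullet> b y"
    and "\<And>x. x \<in> X \<Longrightarrow> (\<integral>y. a x \<bullet> b y \<partial>\<rho>) = S"
proof -
  define I where "I = (top_of_set X) interior_of supp"
  obtain z0 where z0: "z0 \<in> I" using interior by (auto simp: I_def)
  have I: "openin (top_of_set X) I" "I \<subseteq> supp" by (auto simp: I_def interior_of_subset)
  have "z0 \<in> X" using z0 I supp_subset by auto
  have cont: "continuous_on X (\<lambda>y. a x \<bullet> b y)" "continuous_on X (\<lambda>x. a x \<bullet> b y)" for x y
    by (intro continuous_intros cont_a cont_b)+
  \<comment> \<open>A product neighbourhood of \<open>(z0, z0)\<close> inside the open set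
    \<open>P\<close>, intersected with the interior, provides a set \<open>W\<close> on which the
    pairing is positive for all pairs of points and not only on the diagonal.\<close>
  define P where "P = (X \<times> X) \<inter> (\<lambda>p. a (fst p) \<bullet> b (snd p)) -` {0<..}"
  have "continuous_on (X \<times> X) (\<lambda>p. a (fst p) \<bullet> b (snd p))"
    by (intro continuous_intros continuous_on_compose2[OF cont_a] continuous_on_compose2[OF cont_b]) auto
  then have "openin (top_of_set (X \<times> X)) P"
    unfolding P_def by (rule continuous_openin_preimage_gen) simp
  then have P_open: "openin (prod_topology (top_of_set X) (top_of_set X)) P" by simp
  have "(z0, z0) \<in> P" using diag_pos[OF \<open>z0 \<in> X\<close>] \<open>z0 \<in> X\<close> by (simp add: P_def)
  then obtain U V where UV: "openin (top_of_set X) U" "openin (top_of_set X) V" "z0 \<in> U" "z0 \<in> V"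
    "U \<times> V \<subseteq> P" using openin_prod_topology_alt[THEN iffD1, OF P_open, rule_format] by metis
  define W where "W = I \<inter> (U \<inter> V)"
  have W: "openin (top_of_set X) W" "W \<subseteq> supp" "z0 \<in> W"
    unfolding W_def using UV(3,4) I z0 by (intro openin_Int UV(1,2) I(1), blast, blast)
  have WX: "W \<subseteq> X" using W(2) supp_subset by auto
  have W_pos: "0 \<le> a x \<bullet> b y" if "x \<in> W" "y \<in> W" for x y
  proof -
    have "(x, y) \<in> P" using that UV(5) by (auto simp: W_def)
    then show ?thesis by (simp add: P_def)
  qed
  define T where "T = (\<Inter>y\<in>W. X \<inter> (\<lambda>x. a x \<bullet> b y) -` {0..})"
  have T: "closedin (top_of_set X) T"
    unfolding T_def using W(3) by (intro closedin_INT continuous_closedin_preimage cont) auto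
  have T_iff: "x \<in> T \<longleftrightarrow> x \<in> X \<and> (\<forall>y\<in>W. 0 \<le> a x \<bullet> b y)" for x
    using W(3) by (auto simp: T_def)
  have T_sets: "T \<in> sets \<rho>"
  proof -
    have "X - T \<in> sets \<rho>"
      using T by (intro openin_in_sets_restrict_borel[OF sets_rho]) (simp add: closedin_def)
    then have "space \<rho> - (X - T) \<in> sets \<rho>" by (rule sets.compl_sets)
    moreover have "space \<rho> - (X - T) = T" by (auto simp: T_iff)
    ultimately show ?thesis by simp
  qed
  \<comment> \<open>If the pairing of \<open>x\<close> is positive somewhere in \<open>W\<close>,
    the function representing \<open>L x\<close> agrees with the pairing on an open set, hence on
    all of \<open>X\<close>; then the pairing equals \<open>L x\<close> on \<open>W\<close> and
    \<open>x\<close> lies in \<open>T\<close>. Otherwise the pairing is nonpositive on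
    \<open>W\<close>, so \<open>L\<close> vanishes there, and membership in \<open>T\<close> would
    make the pairing vanish too.\<close>
  have L_W: "L z x = indicator T x * (a x \<bullet> b z)" if x: "x \<in> supp" and z: "z \<in> W" for x z
  proof -
    have xz: "x \<in> X" "z \<in> X" using x z supp_subset WX by auto
    have "L x z = indicator T x * (a x \<bullet> b z)"
    proof (cases "\<exists>y0\<in>W. 0 < a x \<bullet> b y0")
      case True
      obtain w where w: "\<And>y. y \<in> W \<Longrightarrow> L x y = w \<bullet> b y"
        using L_represented[OF W(1,2) W_pos x] by blast
      define Q where "Q = W \<inter> (X \<inter> (\<lambda>y. a x \<bullet> b y) -` {0<..})"
      have "openin (top_of_set X) Q"
        unfolding Q_def by (intro openin_Int W continuous_openin_preimage_gen cont) simp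
      moreover have "Q \<noteq> {}" using True WX by (auto simp: Q_def)
      moreover have "(w - a x) \<bullet> b y = 0" if "y \<in> Q" for y
        using that w[of y] by (simp add: Q_def L_def inner_diff_left)
      ultimately have "(w - a x) \<bullet> b y = 0" if "y \<in> X" for y
        using identity[of Q] that by blast
      then have "L x y = a x \<bullet> b y" if "y \<in> W" for y
        using that w WX by (auto simp: inner_diff_left)
      moreover from this have "x \<in> T" unfolding T_iff using xz L_nonneg by metis
      ultimately show ?thesis using z by simp
    next
      case False
      then have "a x \<bullet> b z \<le> 0" using z by force
      moreover have "a x \<bullet> b z = 0" if "x \<in> T"
        using that z \<open>a x \<bullet> b z \<le> 0\<close> unfolding T_iff by force
      ultimately show ?thesis by (auto simp: L_def indicator_def)
    qed
    then show ?thesis using L_sym xz by simp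
  qed
  \<comment> \<open>Integrating the vector \<open>a x\<close> over \<open>T\<close> turns the
    integral of the pairing into a function \<open>A \<bullet> b z\<close>, to which
    \<open>identity\<close> applies.\<close>
  define A where "A = (\<integral>x. (indicator T x :: real) *\<^sub>R a x \<partial>\<rho>)"
  have i: "bounded_meas (indicator T :: 'x \<Rightarrow> real)" by (rule bounded_meas_indicator[OF T_sets])
  note closure = bounded_meas_integrable bounded_meas_mult bounded_meas_scaleR bounded_meas_inner
    bounded_meas_const bounded_meas_b bounded_meas_a bounded_meas_L bounded_meas_minus i
  have A: "A \<bullet> b z = (\<integral>x. indicator T x * (a x \<bullet> b z) \<partial>\<rho>)" for z
    unfolding A_def by (subst integral_inner_left[symmetric]) (auto intro!: closure)
  have "A \<bullet> b z = S" if z: "z \<in> W" for z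
  proof -
    have zX: "z \<in> X" using z WX by auto
    have "A \<bullet> b z = pot (\<lambda>_. 1) z"
      unfolding A pot_def
    proof (rule Bochner_Integration.integral_cong_AE)
      show "AE x in \<rho>. indicator T x * (a x \<bullet> b z) = L z x * 1"
        using AE_supp by eventually_elim (simp add: L_W[OF _ z])
    qed (auto intro!: bounded_meas_measurable closure zX)
    then show ?thesis using pot_one_on_supp z W(2) by auto
  qed
  \<comment> \<open>The Euler-Lagrange equation gives this value only on \<open>W\<close>; the
    identity theorem carries it to all of \<open>X\<close>, in particular to every point of the
    support.\<close>
  then have A_S: "A \<bullet> b z = S" if "z \<in> X" for z
    using identity[OF W(1) _ _ that, of A S] W(3) by blast
  \<comment> \<open>The left side dominates the right side pointwise and both integrate to
    \<open>S\<close>, so they agree almost everywhere.\<close>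
  have AE_L: "AE y in \<rho>. L z y = indicator T y * (a y \<bullet> b z)" if z: "z \<in> supp" for z
  proof -
    have zX: "z \<in> X" using z supp_subset by auto
    define g where "g y = L z y - indicator T y * (a y \<bullet> b z)" for y
    have g: "bounded_meas g" unfolding g_def by (intro closure zX)
    have "(\<integral>y. g y \<partial>\<rho>) = pot (\<lambda>_. 1) z - A \<bullet> b z"
      unfolding g_def A pot_def
      by (subst Bochner_Integration.integral_diff) (auto intro!: closure zX)
    then have "(\<integral>y. g y \<partial>\<rho>) = 0" using pot_one_on_supp[OF z] A_S[OF zX] by simp
    moreover have "0 \<le> g y" if "y \<in> X" for y
      using sym[OF that zX] by (auto simp: g_def L_def indicator_def)
    ultimately have "AE y in \<rho>. g y = 0"
      using integral_nonneg_eq_0_iff_AE[OF bounded_meas_integrable[OF g] AE_I2] by simp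
    then show ?thesis by eventually_elim (simp add: g_def)
  qed
  have supp_T: "supp \<subseteq> T"
  proof
    fix z assume z: "z \<in> supp"
    have zX: "z \<in> X" using z supp_subset by auto
    \<comment> \<open>Almost every \<open>y\<close> outside \<open>T\<close> has
      \<open>L z y = 0\<close>, so the pairing is nonpositive there and \<open>C\<close> has full
      measure. As \<open>C\<close> is closed it contains \<open>z\<close> itself, and positivity on
      the diagonal leaves only \<open>z \<in> T\<close>.\<close>
    define C where "C = T \<union> (X \<inter> (\<lambda>y. a z \<bullet> b y) -` {..0})"
    have "closedin (top_of_set X) C"
      unfolding C_def by (intro closedin_Un T continuous_closedin_preimage cont) auto
    moreover have "AE y in \<rho>. y \<in> C"
      using AE_L[OF z] AE_space
    proof eventually_elim
      case (elim y)
      then show ?case by (cases "y \<in> T") (auto simp: C_def L_def max_def split: if_splits)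
    qed
    ultimately have "z \<in> C" using closedin_contains_supp_on[OF sets_rho] z by blast
    then show "z \<in> T" using diag_pos[OF zX] by (auto simp: C_def)
  qed
  \<comment> \<open>Now the indicator drops out: \<open>AE_L\<close> says that \<open>L\<close>
    equals the pairing almost everywhere, and \<open>A \<bullet> b x\<close> is the integral of the
    pairing over all of \<open>X\<close>.\<close>
  have AE_T: "AE y in \<rho>. y \<in> T" using AE_supp by eventually_elim (use supp_T in auto)
  show "0 \<le> a x \<bullet> b y" if x: "x \<in> supp" and y: "y \<in> supp" for x y
  proof -
    have xX: "x \<in> X" using x supp_subset by auto
    have "AE y in \<rho>. y \<in> X \<inter> (\<lambda>y. a x \<bullet> b y) -` {0..}"
      using AE_T AE_L[OF x] AE_space
    proof eventually_elim
      case (elim y)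
      then have "y \<in> X" "L x y = a x \<bullet> b y" using sym[OF xX, of y] by auto
      then show ?case using L_nonneg[of x y] by simp
    qed
    then have "supp \<subseteq> X \<inter> (\<lambda>y. a x \<bullet> b y) -` {0..}"
      by (intro closedin_contains_supp_on[OF sets_rho] continuous_closedin_preimage cont) auto
    then show ?thesis using y by auto
  qed
  show "(\<integral>y. a x \<bullet> b y \<partial>\<rho>) = S" if x: "x \<in> X" for x
  proof -
    have "(\<integral>y. a x \<bullet> b y \<partial>\<rho>) = A \<bullet> b x"
      unfolding A
    proof (rule Bochner_Integration.integral_cong_AE)
      show "AE y in \<rho>. a x \<bullet> b y = indicator T y * (a y \<bullet> b x)"
        using AE_T AE_space by eventually_elim (use sym[OF x] in auto)
    qed (auto intro!: bounded_meas_measurable closure x)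
    then show ?thesis using A_S[OF x] by simp
  qed
qed

end

section \<open>The flag manifold\<close>

text \<open>The sesquilinear inner product, conjugate-linear in the first argument;
  \<open>\<bullet>\<close> on complex vectors is only its real part.\<close>

definition herm :: "complex ^ 'n \<Rightarrow> complex ^ 'n \<Rightarrow> complex" where
  "herm u v = (\<Sum>i\<in>UNIV. cnj (u $ i) * v $ i)"

text \<open>No normalization is built in, so that non-unit vectors with rescaled coefficients can be
  used in the identity theorem.\<close>

definition spectral_mat :: "complex \<Rightarrow> complex \<Rightarrow> complex ^ 'n \<Rightarrow> complex ^ 'n \<Rightarrow> complex ^ 'n ^ 'n" where
  "spectral_mat c d u v = (\<chi> i j. c * (u $ i * cnj (u $ j)) + d * (v $ i * cnj (v $ j)))"

definition orthonormal_pair :: "complex ^ 'n \<Rightarrow> complex ^ 'n \<Rightarrow> bool" where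
  "orthonormal_pair u v \<longleftrightarrow> herm u u = 1 \<and> herm v v = 1 \<and> herm u v = 0"

lemma herm_add_right: "herm u (v + w) = herm u v + herm u w"
  and herm_diff_right: "herm u (v - w) = herm u v - herm u w"
  and herm_scale_right: "herm u (c *s v) = c * herm u v"
  and herm_scale_left: "herm (c *s u) v = cnj c * herm u v"
  by (simp_all add: herm_def sum.distrib sum_subtractf sum_distrib_left algebra_simps)

lemma cnj_herm: "cnj (herm u v) = herm v u"
  by (simp add: herm_def mult.commute)

lemma herm_zero [simp]: "herm u 0 = 0" "herm 0 u = 0"
  by (simp_all add: herm_def)

lemma herm_self: "herm u u = complex_of_real ((norm u)\<^sup>2)"
proof -
  have "(norm u)\<^sup>2 = (\<Sum>i\<in>UNIV. (norm (u $ i))\<^sup>2)"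
    by (simp add: norm_vec_def L2_set_def sum_nonneg)
  then show ?thesis
    by (simp only: herm_def of_real_sum complex_norm_square mult.commute)
qed

lemma orthonormal_pair_sym: "orthonormal_pair u v \<Longrightarrow> herm v u = 0"
  using cnj_herm[of u v] by (simp add: orthonormal_pair_def)

lemma spectral_mat_mult_vec:
  "spectral_mat c d u v *v w = (c * herm u w) *s u + (d * herm v w) *s v"
  by (simp add: vec_eq_iff matrix_vector_mult_def spectral_mat_def herm_def
      sum_distrib_left sum.distrib algebra_simps)

lemma hermitian_spectral_mat:
  "hermitian_mat (spectral_mat (complex_of_real c) (complex_of_real d) u v)"
  by (simp add: hermitian_mat_def vec_eq_iff map_matrix_def transpose_def spectral_mat_def mult.commute)

lemma hermitian_nth: "hermitian_mat A \<Longrightarrow> cnj (A $ i $ j) = A $ j $ i"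
proof -
  assume "hermitian_mat A"
  then have "map_matrix cnj (transpose A) $ j $ i = A $ j $ i" by (simp add: hermitian_mat_def)
  then show ?thesis by (simp add: transpose_def)
qed

lemma herm_mult_vec: "hermitian_mat A \<Longrightarrow> herm (A *v u) v = herm u (A *v v)"
proof -
  assume A: "hermitian_mat A"
  have "herm (A *v u) v = (\<Sum>i\<in>UNIV. \<Sum>j\<in>UNIV. cnj (u $ j) * (A $ j $ i * v $ i))"
    by (simp add: herm_def matrix_vector_mult_def sum_distrib_right sum_distrib_left hermitian_nth[OF A] mult_ac)
  also have "\<dots> = herm u (A *v v)"
    by (subst sum.swap) (simp add: herm_def matrix_vector_mult_def sum_distrib_left)
  finally show ?thesis .
qed

text \<open>The conjugate transpose of the eigenvalue equation expresses the conjugate of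
  \<open>u\<close> through the rows of \<open>A\<close>; division by \<open>c\<close> is possible as
  it is nonzero.\<close>

lemma eigenvector_in_row_span:
  assumes A: "hermitian_mat A" and "A *v u = complex_of_real c *s u" "c \<noteq> 0"
  shows "(\<chi> j. cnj (u $ j)) \<in> vec.span (rows A)"
proof -
  have eq: "(\<chi> j. cnj (u $ j)) = complex_of_real (1 / c) *s (\<Sum>i\<in>UNIV. cnj (u $ i) *s row i A)"
  proof (subst vec_eq_iff, rule allI)
    fix j
    have "complex_of_real c * u $ j = (A *v u) $ j" using assms(2) by simp
    also have "\<dots> = (\<Sum>i\<in>UNIV. A $ j $ i * u $ i)" by (simp add: matrix_vector_mult_def)
    finally have "cnj (complex_of_real c * u $ j) = cnj (\<Sum>i\<in>UNIV. A $ j $ i * u $ i)" by simp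
    then have "complex_of_real c * cnj (u $ j) = (\<Sum>i\<in>UNIV. cnj (u $ i) * A $ i $ j)"
      by (simp add: hermitian_nth[OF A] mult.commute)
    then show "(\<chi> j. cnj (u $ j)) $ j = (complex_of_real (1 / c) *s (\<Sum>i\<in>UNIV. cnj (u $ i) *s row i A)) $ j"
      using \<open>c \<noteq> 0\<close> by (simp add: row_def field_simps)
  qed
  have "row i A \<in> rows A" for i by (auto simp: rows_def)
  then show ?thesis
    unfolding eq by (intro vec.span_scale vec.span_sum vec.span_base)
qed

lemma independent_conj_orthonormal_pair:
  assumes uv: "orthonormal_pair u v"
  shows "vec.independent {\<chi> j. cnj (u $ j), \<chi> j. cnj (v $ j)}"
    and "card {\<chi> j. cnj (u $ j), \<chi> j. cnj (v $ j)} = 2"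
proof -
  define u' v' where "u' = (\<chi> j. cnj (u $ j))" and "v' = (\<chi> j. cnj (v $ j))"
  have uv': "herm u' u' = 1" "herm v' v' = 1" "herm u' v' = 0"
    using uv orthonormal_pair_sym[OF uv]
    by (simp_all add: orthonormal_pair_def herm_def u'_def v'_def mult.commute)
  then have "u' \<noteq> v'" by auto
  then show "card {\<chi> j. cnj (u $ j), \<chi> j. cnj (v $ j)} = 2"
    unfolding u'_def[symmetric] v'_def[symmetric] by simp
  have "v' \<noteq> 0" using uv' by auto
  moreover have "u' \<notin> vec.span {v'}"
  proof
    assume "u' \<in> vec.span {v'}"
    then obtain k where "u' = k *s v'" unfolding vec.span_singleton by auto
    then have "herm u' u' = k * herm u' v'" by (metis herm_scale_right)
    then show False using uv' by simp
  qed
  ultimately show "vec.independent {\<chi> j. cnj (u $ j), \<chi> j. cnj (v $ j)}"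
    unfolding u'_def[symmetric] v'_def[symmetric]
    using \<open>u' \<noteq> v'\<close> by (simp add: vec.independent_insert)
qed

lemma spectral_mat_mult_fst:
    "orthonormal_pair u v \<Longrightarrow> spectral_mat c d u v *v u = c *s u"
  and spectral_mat_mult_snd:
    "orthonormal_pair u v \<Longrightarrow> spectral_mat c d u v *v v = d *s v"
  using orthonormal_pair_sym[of u v] by (simp_all add: spectral_mat_mult_vec orthonormal_pair_def)

text \<open>The parametrization by orthonormal frames. Eigenvectors for the two distinct real
  eigenvalues are orthogonal, and their conjugates lie in the row span, which they exhaust because
  the rank is two. Applying \<open>x\<close> to \<open>u\<close> and \<open>v\<close> then
  determines the coefficients of each row. Conversely, the row span and the spectrum are read off
  from the frame.\<close>

lemma flagmf_eq:
  assumes "\<tau> > 1"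
  shows "flagmf \<tau> = {spectral_mat (complex_of_real (1 + \<tau>)) (complex_of_real (1 - \<tau>)) u v | u v.
    orthonormal_pair u v}"
proof (intro equalityI subsetI)
  fix x :: "complex ^ 'n ^ 'n" assume x: "x \<in> flagmf \<tau>"
  then have h: "hermitian_mat x" and r: "rank x = 2"
    and e: "eigenvals x - {0} = {complex_of_real (1 + \<tau>), complex_of_real (1 - \<tau>)}"
    by (auto simp: flagmf_def)
  have unit: "\<exists>u. herm u u = 1 \<and> x *v u = c *s u" if "c \<in> eigenvals x" for c
  proof -
    from that obtain w where w: "w \<noteq> 0" "x *v w = c *s w" by (auto simp: eigenvals_def)
    define u where "u = complex_of_real (1 / norm w) *s w"
    have "herm u u = 1" using w(1)
      unfolding u_def herm_scale_left herm_scale_right by (simp add: herm_self power2_eq_square)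
    moreover have "x *v u = c *s u"
      by (simp add: u_def vector_scalar_commute w(2) mult.commute)
    ultimately show ?thesis by blast
  qed
  obtain u where u: "herm u u = 1" "x *v u = complex_of_real (1 + \<tau>) *s u"
    using unit[of "complex_of_real (1 + \<tau>)"] e by blast
  obtain v where v: "herm v v = 1" "x *v v = complex_of_real (1 - \<tau>) *s v"
    using unit[of "complex_of_real (1 - \<tau>)"] e by blast
  have "complex_of_real (1 + \<tau>) * herm u v = complex_of_real (1 - \<tau>) * herm u v"
    using herm_mult_vec[OF h, of u v] unfolding u(2) v(2) herm_scale_left herm_scale_right by simp
  then have "complex_of_real (2 * \<tau>) * herm u v = 0" by (simp add: algebra_simps)
  then have "herm u v = 0" using assms by simp
  with u v have uv: "orthonormal_pair u v" by (simp add: orthonormal_pair_def)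
  define u' v' where "u' = (\<chi> j. cnj (u $ j))" and "v' = (\<chi> j. cnj (v $ j))"
  note ind = independent_conj_orthonormal_pair[OF uv, folded u'_def v'_def]
  have "{u', v'} \<subseteq> vec.span (rows x)"
    using eigenvector_in_row_span[OF h u(2)] eigenvector_in_row_span[OF h v(2)] assms
    by (simp add: u'_def v'_def)
  moreover have "vec.dim (vec.span (rows x)) \<le> card {u', v'}"
    using r ind(2) by (simp add: row_rank_def_gen)
  ultimately have "vec.span (rows x) \<subseteq> vec.span {u', v'}"
    using vec.card_ge_dim_independent[OF _ ind(1)] by blast
  then have rows: "row i x \<in> vec.span {u', v'}" for i
    using vec.span_base[of "row i x" "rows x"] by (auto simp: rows_def)
  have "x $ i $ j = spectral_mat (complex_of_real (1 + \<tau>)) (complex_of_real (1 - \<tau>)) u v $ i $ j" for i j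
  proof -
    obtain k l where kl: "row i x = k *s u' + l *s v'"
      using rows[of i] by (auto simp: vec.span_insert vec.span_singleton algebra_simps)
    then have xi: "x $ i $ j = k * cnj (u $ j) + l * cnj (v $ j)" for j
      by (simp add: vec_eq_iff row_def u'_def v'_def)
    have "(x *v w) $ i = k * herm u w + l * herm v w" for w
      by (simp add: matrix_vector_mult_def xi herm_def sum_distrib_left sum.distrib algebra_simps)
    from this[of u] this[of v] have "k = complex_of_real (1 + \<tau>) * u $ i" "l = complex_of_real (1 - \<tau>) * v $ i"
      using uv orthonormal_pair_sym[OF uv] unfolding u(2) v(2)
      by (simp_all add: orthonormal_pair_def) (simp_all add: algebra_simps)
    then show ?thesis by (simp add: xi spectral_mat_def mult.assoc)
  qed
  then have "x = spectral_mat (complex_of_real (1 + \<tau>)) (complex_of_real (1 - \<tau>)) u v"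
    by (simp add: vec_eq_iff)
  with uv show "x \<in> {spectral_mat (complex_of_real (1 + \<tau>)) (complex_of_real (1 - \<tau>)) u v | u v.
    orthonormal_pair u v}" by blast
next
  fix x :: "complex ^ 'n ^ 'n"
  assume "x \<in> {spectral_mat (complex_of_real (1 + \<tau>)) (complex_of_real (1 - \<tau>)) u v | u v.
    orthonormal_pair u v}"
  then obtain u v where uv: "orthonormal_pair u v"
    and x: "x = spectral_mat (complex_of_real (1 + \<tau>)) (complex_of_real (1 - \<tau>)) u v" by blast
  note sym = orthonormal_pair_sym[OF uv]
  have uv1: "herm u u = 1" "herm v v = 1" "herm u v = 0" using uv by (auto simp: orthonormal_pair_def)
  have h: "hermitian_mat x" unfolding x by (rule hermitian_spectral_mat)
  have xu: "x *v u = complex_of_real (1 + \<tau>) *s u" and xv: "x *v v = complex_of_real (1 - \<tau>) *s v"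
    unfolding x using uv by (simp_all only: spectral_mat_mult_fst spectral_mat_mult_snd)
  define u' v' where "u' = (\<chi> j. cnj (u $ j))" and "v' = (\<chi> j. cnj (v $ j))"
  note ind = independent_conj_orthonormal_pair[OF uv, folded u'_def v'_def]
  have "{u', v'} \<subseteq> vec.span (rows x)"
    using eigenvector_in_row_span[OF h xu] eigenvector_in_row_span[OF h xv] assms
    by (simp add: u'_def v'_def)
  moreover have "row i x \<in> vec.span {u', v'}" for i
  proof -
    have "row i x = (complex_of_real (1 + \<tau>) * u $ i) *s u' + (complex_of_real (1 - \<tau>) * v $ i) *s v'"
      by (simp add: vec_eq_iff row_def x spectral_mat_def u'_def v'_def mult.assoc)
    moreover have "k *s u' + l *s v' \<in> vec.span {u', v'}" for k l
      by (intro vec.span_add vec.span_scale vec.span_base) auto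
    ultimately show ?thesis by (simp only:)
  qed
  then have "rows x \<subseteq> vec.span {u', v'}" by (auto simp: rows_def)
  ultimately have "vec.span (rows x) = vec.span {u', v'}" by (simp add: vec.span_eq)
  then have r: "rank x = 2"
    using vec.dim_span[of "rows x"] vec.dim_span[of "{u', v'}"] vec.dim_eq_card_independent[OF ind(1)] ind(2)
    by (simp add: row_rank_def_gen)
  have ev: "c = complex_of_real (1 + \<tau>) \<or> c = complex_of_real (1 - \<tau>)"
    if c: "c \<in> eigenvals x" "c \<noteq> 0" for c
  proof -
    obtain w where w: "w \<noteq> 0" "x *v w = c *s w" using c by (auto simp: eigenvals_def)
    have eq: "c *s w = (complex_of_real (1 + \<tau>) * herm u w) *s u + (complex_of_real (1 - \<tau>) * herm v w) *s v"
      using w(2) unfolding x spectral_mat_mult_vec by simp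
    have "herm u (c *s w) = complex_of_real (1 + \<tau>) * herm u w"
      "herm v (c *s w) = complex_of_real (1 - \<tau>) * herm v w"
      unfolding eq herm_add_right herm_scale_right by (simp_all add: uv1 sym)
    then have "c = complex_of_real (1 + \<tau>) \<or> herm u w = 0" "c = complex_of_real (1 - \<tau>) \<or> herm v w = 0"
      unfolding herm_scale_right by auto
    moreover have "\<not> (herm u w = 0 \<and> herm v w = 0)"
      using eq c(2) w(1) by auto
    ultimately show ?thesis by blast
  qed
  have "u \<noteq> 0" "v \<noteq> 0" using uv1 by auto
  then have "complex_of_real (1 + \<tau>) \<in> eigenvals x" "complex_of_real (1 - \<tau>) \<in> eigenvals x"
    unfolding eigenvals_def using xu xv by blast+
  moreover have "complex_of_real (1 + \<tau>) \<noteq> 0" "complex_of_real (1 - \<tau>) \<noteq> 0"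
    unfolding of_real_eq_0_iff using assms by simp_all
  ultimately have "eigenvals x - {0} = {complex_of_real (1 + \<tau>), complex_of_real (1 - \<tau>)}"
    using ev by (intro equalityI subsetI) (auto simp del: of_real_add of_real_diff)
  with h r show "x \<in> flagmf \<tau>" by (simp add: flagmf_def)
qed

section \<open>Boundedness of the flag manifold and the diagonal values of
  \<open>Dfun\<close>\<close>

lemma continuous_on_spectral_mat:
  assumes "continuous_on A c" "continuous_on A d" "continuous_on A u" "continuous_on A v"
  shows "continuous_on A (\<lambda>t. spectral_mat (c t) (d t) (u t) (v t))"
  unfolding spectral_mat_def
  by (intro continuous_on_vec_lambda continuous_intros assms)

lemma continuous_on_herm:
  assumes "continuous_on A u" "continuous_on A v"
  shows "continuous_on A (\<lambda>t. herm (u t) (v t))"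
  unfolding herm_def by (intro continuous_intros assms)

lemma bounded_flagmf:
  assumes "\<tau> > 1"
  shows "bounded (flagmf \<tau> :: (complex ^ 'n ^ 'n) set)"
proof -
  let ?f = "\<lambda>p::(complex ^ 'n) \<times> (complex ^ 'n).
    spectral_mat (complex_of_real (1 + \<tau>)) (complex_of_real (1 - \<tau>)) (fst p) (snd p)"
  have "flagmf \<tau> \<subseteq> ?f ` (cball 0 1 \<times> cball 0 1)"
  proof
    fix x :: "complex ^ 'n ^ 'n" assume "x \<in> flagmf \<tau>"
    then obtain u v where uv: "orthonormal_pair u v" "x = ?f (u, v)"
      unfolding flagmf_eq[OF assms] by auto
    have "norm w = 1" if "herm w w = 1" for w :: "complex ^ 'n"
    proof (rule power2_eq_imp_eq)
      show "(norm w)\<^sup>2 = 1\<^sup>2" using that unfolding herm_self by (simp only: of_real_eq_1_iff one_power2)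
    qed auto
    with uv(1) have "norm u = 1" "norm v = 1" by (simp_all add: orthonormal_pair_def)
    then show "x \<in> ?f ` (cball 0 1 \<times> cball 0 1)" using uv(2) by (intro image_eqI[of _ _ "(u, v)"]) auto
  qed
  moreover have "compact (?f ` (cball 0 1 \<times> cball 0 1))"
    by (intro compact_continuous_image continuous_on_spectral_mat continuous_intros compact_Times) auto
  ultimately show ?thesis using bounded_subset compact_imp_bounded by blast
qed

lemma spectral_mat_mult:
  assumes "orthonormal_pair u v"
  shows "spectral_mat c d u v ** spectral_mat c' d' u v = spectral_mat (c * c') (d * d') u v"
proof -
  have 1: "herm u u = 1" "herm v v = 1" "herm u v = 0" "herm v u = 0"
    using assms orthonormal_pair_sym[OF assms] by (auto simp: orthonormal_pair_def)
  have "(spectral_mat c d u v ** spectral_mat c' d' u v) $ i $ j =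
    c * c' * u $ i * cnj (u $ j) * herm u u + c * d' * u $ i * cnj (v $ j) * herm u v +
    d * c' * v $ i * cnj (u $ j) * herm v u + d * d' * v $ i * cnj (v $ j) * herm v v" for i j
    unfolding herm_def sum_distrib_left sum.distrib[symmetric]
    by (simp add: matrix_matrix_mult_def spectral_mat_def algebra_simps)
  then show ?thesis unfolding 1 by (simp add: vec_eq_iff spectral_mat_def mult_ac)
qed

lemma trace_spectral_mat: "trace (spectral_mat c d u v) = c * herm u u + d * herm v v"
  by (simp add: trace_def spectral_mat_def herm_def sum_distrib_left sum.distrib mult_ac)

text \<open>With eigenvalues \<open>p\<close> and \<open>q\<close> the value is
  \<open>p^4 + q^4 - (p^2 + q^2)^2 / 2 = (p^2 - q^2)^2 / 2\<close>, and here
  \<open>p^2 - q^2\<close> is \<open>4 * \<tau>\<close>.\<close>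

lemma Dfun_diag:
  assumes "\<tau> > 1" "x \<in> flagmf \<tau>"
  shows "Dfun x x = 8 * \<tau>\<^sup>2"
proof -
  obtain u v where uv: "orthonormal_pair u v"
    and x: "x = spectral_mat (complex_of_real (1 + \<tau>)) (complex_of_real (1 - \<tau>)) u v"
    using assms flagmf_eq by blast
  have 1: "herm u u = 1" "herm v v = 1" using uv by (auto simp: orthonormal_pair_def)
  have "trace (x ** x) = complex_of_real ((1 + \<tau>)\<^sup>2 + (1 - \<tau>)\<^sup>2)"
    unfolding x spectral_mat_mult[OF uv] trace_spectral_mat 1 by (simp add: power2_eq_square)
  moreover have "trace ((x ** x) ** (x ** x)) = complex_of_real ((1 + \<tau>) ^ 4 + (1 - \<tau>) ^ 4)"
    unfolding x spectral_mat_mult[OF uv] trace_spectral_mat 1 by (simp add: power4_eq_xxxx)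
  ultimately have "Dfun x x = (1 + \<tau>) ^ 4 + (1 - \<tau>) ^ 4 - 1/2 * ((1 + \<tau>)\<^sup>2 + (1 - \<tau>)\<^sup>2)\<^sup>2"
    unfolding Dfun_def by (simp only: Re_complex_of_real)
  also have "\<dots> = 8 * \<tau>\<^sup>2" by (simp add: power2_eq_square power4_eq_xxxx algebra_simps)
  finally show ?thesis .
qed


section \<open>The finite-rank form of \<open>Dfun\<close>\<close>

definition quad_monomials :: "complex ^ 'n ^ 'n \<Rightarrow> complex ^ 'n ^ 'n ^ 'n ^ 'n" where
  "quad_monomials y = (\<chi> p q r s. y $ p $ q * y $ r $ s)"

text \<open>The index pattern is that of the closed loop \<open>s p q r\<close> in the trace of
  \<open>x y x y\<close>, minus that of the product of two traces. The conjugation cancels the one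
  hidden in the real inner product of complex numbers.\<close>

definition D_coeffs :: "complex ^ 'n ^ 'n \<Rightarrow> complex ^ 'n ^ 'n ^ 'n ^ 'n" where
  "D_coeffs x = (\<chi> p q r s. cnj (x $ s $ p * x $ q $ r - 1/2 * (x $ q $ p * x $ s $ r)))"

lemma continuous_on_quad_monomials: "continuous_on A quad_monomials"
  unfolding quad_monomials_def by (intro continuous_on_vec_lambda continuous_intros)

lemma continuous_on_D_coeffs: "continuous_on A D_coeffs"
  unfolding D_coeffs_def by (intro continuous_on_vec_lambda continuous_intros)

lemma inner_complex_cnj: "z \<bullet> w = Re (cnj z * w)"
  by (simp add: inner_complex_def)

lemma inner_quad_monomials:
  "w \<bullet> quad_monomials y = Re (\<Sum>p\<in>UNIV. \<Sum>q\<in>UNIV. \<Sum>r\<in>UNIV. \<Sum>s\<in>UNIV.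
     cnj (w $ p $ q $ r $ s) * (y $ p $ q * y $ r $ s))"
  by (simp add: inner_vec_def quad_monomials_def inner_complex_cnj)

lemma Dfun_eq_inner:
  assumes x: "hermitian_mat x" and y: "hermitian_mat y"
  shows "Dfun x y = D_coeffs x \<bullet> quad_monomials y"
proof -
  have "trace ((x ** y) ** (x ** y)) = (\<Sum>s\<in>UNIV. \<Sum>q\<in>UNIV.
      (\<Sum>p\<in>UNIV. x $ s $ p * y $ p $ q) * (\<Sum>r\<in>UNIV. x $ q $ r * y $ r $ s))"
    by (simp add: trace_def matrix_matrix_mult_def)
  also have "\<dots> = (\<Sum>s\<in>UNIV. \<Sum>q\<in>UNIV. \<Sum>p\<in>UNIV. \<Sum>r\<in>UNIV.
      x $ s $ p * x $ q $ r * (y $ p $ q * y $ r $ s))"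
    by (simp add: sum_product mult_ac)
  \<comment> \<open>From here the four sums are only reordered, to match the nesting
    \<open>p q r s\<close> of the tensor.\<close>
  also have "\<dots> = (\<Sum>s\<in>UNIV. \<Sum>p\<in>UNIV. \<Sum>q\<in>UNIV. \<Sum>r\<in>UNIV.
      x $ s $ p * x $ q $ r * (y $ p $ q * y $ r $ s))"
    by (rule sum.cong[OF refl], rule sum.swap)
  also have "\<dots> = (\<Sum>p\<in>UNIV. \<Sum>s\<in>UNIV. \<Sum>q\<in>UNIV. \<Sum>r\<in>UNIV.
      x $ s $ p * x $ q $ r * (y $ p $ q * y $ r $ s))"
    by (rule sum.swap)
  also have "\<dots> = (\<Sum>p\<in>UNIV. \<Sum>q\<in>UNIV. \<Sum>s\<in>UNIV. \<Sum>r\<in>UNIV.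
      x $ s $ p * x $ q $ r * (y $ p $ q * y $ r $ s))"
    by (rule sum.cong[OF refl], rule sum.swap)
  also have "\<dots> = (\<Sum>p\<in>UNIV. \<Sum>q\<in>UNIV. \<Sum>r\<in>UNIV. \<Sum>s\<in>UNIV.
      x $ s $ p * x $ q $ r * (y $ p $ q * y $ r $ s))"
    by (rule sum.cong[OF refl], rule sum.cong[OF refl], rule sum.swap)
  finally have 1: "trace ((x ** y) ** (x ** y)) = (\<Sum>p\<in>UNIV. \<Sum>q\<in>UNIV. \<Sum>r\<in>UNIV. \<Sum>s\<in>UNIV.
      x $ s $ p * x $ q $ r * (y $ p $ q * y $ r $ s))" .
  have tr: "trace (x ** y) = (\<Sum>p\<in>UNIV. \<Sum>q\<in>UNIV. x $ q $ p * y $ p $ q)"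
    by (subst sum.swap) (simp add: trace_def matrix_matrix_mult_def)
  have "(trace (x ** y))\<^sup>2 = (\<Sum>p\<in>UNIV. \<Sum>q\<in>UNIV. x $ q $ p * y $ p $ q * (\<Sum>r\<in>UNIV. \<Sum>s\<in>UNIV. x $ s $ r * y $ r $ s))"
    by (simp add: power2_eq_square tr sum_distrib_right)
  also have "\<dots> = (\<Sum>p\<in>UNIV. \<Sum>q\<in>UNIV. \<Sum>r\<in>UNIV. \<Sum>s\<in>UNIV.
      x $ q $ p * x $ s $ r * (y $ p $ q * y $ r $ s))"
    by (simp add: sum_distrib_left mult_ac)
  finally have 2: "(trace (x ** y))\<^sup>2 = (\<Sum>p\<in>UNIV. \<Sum>q\<in>UNIV. \<Sum>r\<in>UNIV. \<Sum>s\<in>UNIV.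
      x $ q $ p * x $ s $ r * (y $ p $ q * y $ r $ s))" .
  \<comment> \<open>Reality of the trace is what allows the real part to be taken after squaring
    instead of before.\<close>
  obtain t where t: "trace (x ** y) = complex_of_real t"
    using trace_hermitian_real(1)[OF x y] by (auto elim: Reals_cases)
  have "D_coeffs x \<bullet> quad_monomials y =
      Re (trace ((x ** y) ** (x ** y)) - 1/2 * (trace (x ** y))\<^sup>2)"
    unfolding inner_quad_monomials 1 2 sum_distrib_left sum_subtractf[symmetric]
    by (simp add: D_coeffs_def algebra_simps)
  also have "\<dots> = Dfun x y" by (simp add: Dfun_def t flip: of_real_power)
  finally show ?thesis ..
qed

lemma Dfun_sym: "Dfun x y = Dfun y x"
proof -
  have "trace ((x ** y) ** (x ** y)) = trace (x ** (y ** x ** y))"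
    by (simp only: matrix_mul_assoc)
  also have "\<dots> = trace ((y ** x ** y) ** x)" by (rule trace_mul_sym)
  finally have "trace ((x ** y) ** (x ** y)) = trace ((y ** x) ** (y ** x))"
    by (simp only: matrix_mul_assoc)
  then show ?thesis by (simp add: Dfun_def trace_mul_sym[of x y])
qed

section \<open>Polynomial functions of a real parameter and the identity theorem\<close>

definition poly_fun :: "(real \<Rightarrow> complex) \<Rightarrow> bool" where
  "poly_fun f \<longleftrightarrow> (\<exists>p. \<forall>t. f t = poly p (complex_of_real t))"

lemma poly_fun_const: "poly_fun (\<lambda>t. c)"
  unfolding poly_fun_def by (intro exI[of _ "[:c:]"]) simp

lemma poly_fun_of_real: "poly_fun complex_of_real"
  unfolding poly_fun_def by (intro exI[of _ "[:0, 1:]"]) simp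

lemma poly_fun_add: "poly_fun f \<Longrightarrow> poly_fun g \<Longrightarrow> poly_fun (\<lambda>t. f t + g t)"
  unfolding poly_fun_def by (metis poly_add)

lemma poly_fun_diff: "poly_fun f \<Longrightarrow> poly_fun g \<Longrightarrow> poly_fun (\<lambda>t. f t - g t)"
  unfolding poly_fun_def by (metis poly_diff)

lemma poly_fun_mult: "poly_fun f \<Longrightarrow> poly_fun g \<Longrightarrow> poly_fun (\<lambda>t. f t * g t)"
  unfolding poly_fun_def by (metis poly_mult)

text \<open>The parameter is real, so conjugating the coefficients conjugates the function. This
  keeps Hermitian inner products of polynomial curves polynomial.\<close>

lemma poly_fun_cnj: "poly_fun f \<Longrightarrow> poly_fun (\<lambda>t. cnj (f t))"
  unfolding poly_fun_def by (metis poly_cnj complex_cnj_complex_of_real)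

lemma poly_fun_sum: "(\<And>i. i \<in> I \<Longrightarrow> poly_fun (f i)) \<Longrightarrow> poly_fun (\<lambda>t. \<Sum>i\<in>I. f i t)"
  by (induction I rule: infinite_finite_induct) (auto intro: poly_fun_add poly_fun_const)

lemma poly_fun_Re:
  assumes "poly_fun f"
  shows "poly_fun (\<lambda>t. complex_of_real (Re (f t)))"
proof -
  have "poly_fun (\<lambda>t. 1/2 * (f t + cnj (f t)))"
    by (intro poly_fun_mult poly_fun_add poly_fun_cnj poly_fun_const assms)
  then show ?thesis by (simp add: complex_add_cnj)
qed

lemma poly_fun_herm:
  assumes "\<And>i. poly_fun (\<lambda>t. u t $ i)" "\<And>i. poly_fun (\<lambda>t. v t $ i)"
  shows "poly_fun (\<lambda>t. herm (u t) (v t))"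
  unfolding herm_def by (intro poly_fun_sum poly_fun_mult poly_fun_cnj assms)

lemma poly_fun_eq_0:
  assumes "poly_fun f" "0 < e" "\<And>t. \<bar>t\<bar> < e \<Longrightarrow> f t = 0"
  shows "f t = 0"
proof -
  obtain p where p: "\<And>t. f t = poly p (complex_of_real t)" using assms(1) by (auto simp: poly_fun_def)
  have "infinite (complex_of_real ` {-e<..<e})"
    using \<open>0 < e\<close> by (simp add: finite_image_iff inj_on_def)
  moreover have "complex_of_real ` {-e<..<e} \<subseteq> {z. poly p z = 0}"
    using assms(3) p by fastforce
  ultimately have "p = 0" using poly_roots_finite finite_subset by blast
  then show ?thesis by (simp add: p)
qed


lemma poly_fun_spectral_mat:
  assumes "poly_fun c" "poly_fun d" "\<And>i. poly_fun (\<lambda>t. u t $ i)" "\<And>i. poly_fun (\<lambda>t. v t $ i)"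
  shows "poly_fun (\<lambda>t. spectral_mat (c t) (d t) (u t) (v t) $ i $ j)"
  unfolding spectral_mat_def vec_lambda_beta
  by (intro poly_fun_add poly_fun_mult poly_fun_cnj assms)

lemma poly_fun_inner_quad_monomials:
  assumes "\<And>i j. poly_fun (\<lambda>t. z t $ i $ j)"
  shows "poly_fun (\<lambda>t. complex_of_real (w \<bullet> quad_monomials (z t)))"
  unfolding inner_quad_monomials
  by (intro poly_fun_Re poly_fun_sum poly_fun_mult poly_fun_const assms)

lemma herm_self_eq_0_iff: "herm u u = 0 \<longleftrightarrow> u = 0"
  by (simp add: herm_self)

text \<open>Dividing the coefficients by \<open>herm u u\<close> and \<open>herm v v\<close>
  replaces the normalization of the vectors. No square roots occur, so the matrix depends rationally
  on the frame and its conjugate.\<close>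

lemma spectral_mat_in_flagmf:
  assumes "\<tau> > 1" "u \<noteq> 0" "v \<noteq> 0" "herm u v = 0"
  shows "spectral_mat (complex_of_real (1 + \<tau>) / herm u u) (complex_of_real (1 - \<tau>) / herm v v) u v \<in> flagmf \<tau>"
proof -
  define u' v' where "u' = complex_of_real (1 / norm u) *s u" and "v' = complex_of_real (1 / norm v) *s v"
  have "orthonormal_pair u' v'"
    unfolding orthonormal_pair_def u'_def v'_def herm_scale_left herm_scale_right assms(4)
    using assms(2,3) by (simp add: herm_self power2_eq_square)
  moreover have "spectral_mat (complex_of_real (1 + \<tau>) / herm u u) (complex_of_real (1 - \<tau>) / herm v v) u v =
      spectral_mat (complex_of_real (1 + \<tau>)) (complex_of_real (1 - \<tau>)) u' v'"
    by (simp add: vec_eq_iff spectral_mat_def u'_def v'_def herm_self power2_eq_square)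
  ultimately show ?thesis unfolding flagmf_eq[OF assms(1)] by blast
qed

text \<open>Any point is joined to a point of \<open>U\<close> by a curve rational in a real
  parameter. After multiplication by the denominators, the difference from \<open>c\<close> is a
  polynomial that vanishes near \<open>t = 0\<close>, hence also at \<open>t = 1\<close>.\<close>

lemma flagmf_identity:
  fixes U :: "(complex ^ 'n ^ 'n) set"
  assumes "\<tau> > 1" and U: "openin (top_of_set (flagmf \<tau>)) U" "U \<noteq> {}"
    and eq: "\<And>y. y \<in> U \<Longrightarrow> w \<bullet> quad_monomials y = c" and y: "y \<in> flagmf \<tau>"
  shows "w \<bullet> quad_monomials y = c"
proof -
  define \<alpha> \<beta> where "\<alpha> = complex_of_real (1 + \<tau>)" and "\<beta> = complex_of_real (1 - \<tau>)"
  obtain y0 where y0: "y0 \<in> U" using U(2) by blast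
  then have "y0 \<in> flagmf \<tau>" using U(1) openin_imp_subset by blast
  then obtain u0 v0 where uv0: "orthonormal_pair u0 v0" "y0 = spectral_mat \<alpha> \<beta> u0 v0"
    unfolding flagmf_eq[OF assms(1)] \<alpha>_def \<beta>_def by blast
  obtain u1 v1 where uv1: "orthonormal_pair u1 v1" "y = spectral_mat \<alpha> \<beta> u1 v1"
    using y unfolding flagmf_eq[OF assms(1)] \<alpha>_def \<beta>_def by blast
  \<comment> \<open>Join the two frames by line segments and orthogonalise.  \<open>Z t\<close> is \<open>z t\<close> with the denominators
    cleared, so \<open>G\<close> is a polynomial in \<open>t\<close>; where \<open>M\<close> or \<open>N\<close> vanishes, \<open>z t\<close> is meaningless.\<close>
  define u where "u t = u0 + complex_of_real t *s (u1 - u0)" for t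
  define v where "v t = v0 + complex_of_real t *s (v1 - v0)" for t
  define g where "g t = herm (u t) (u t) *s v t - herm (u t) (v t) *s u t" for t
  define M where "M t = herm (u t) (u t)" for t
  define N where "N t = herm (g t) (g t)" for t
  define z where "z t = spectral_mat (\<alpha> / M t) (\<beta> / N t) (u t) (g t)" for t
  define Z where "Z t = spectral_mat (\<alpha> * N t) (\<beta> * M t) (u t) (g t)" for t
  define G where "G t = complex_of_real (w \<bullet> quad_monomials (Z t)) - complex_of_real c * (M t * N t)\<^sup>2" for t
  have orth: "herm (u t) (g t) = 0" for t
    by (simp add: g_def herm_diff_right herm_scale_right)
  have cont_u: "continuous_on A u" and cont_v: "continuous_on A v" for A
    unfolding u_def v_def vector_scalar_mult_def
    by (intro continuous_intros continuous_on_vec_lambda)+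
  have cont_g: "continuous_on A g" for A
    unfolding g_def vector_scalar_mult_def
    by (intro continuous_intros continuous_on_vec_lambda continuous_on_herm cont_u cont_v)
  have cont_M: "continuous_on A M" and cont_N: "continuous_on A N" for A
    unfolding M_def N_def by (intro continuous_on_herm cont_u cont_g)+
  have G_z: "G t = complex_of_real (w \<bullet> quad_monomials (z t) - c) * (M t * N t)\<^sup>2"
    if "M t \<noteq> 0" "N t \<noteq> 0" for t
  proof -
    define m n where "m = (norm (u t))\<^sup>2" and "n = (norm (g t))\<^sup>2"
    have mn: "M t = complex_of_real m" "N t = complex_of_real n"
      by (simp_all only: M_def N_def herm_self m_def n_def)
    have Zz: "Z t $ i $ j = complex_of_real (m * n) * z t $ i $ j" for i j
      using that by (simp add: Z_def z_def spectral_mat_def mn algebra_simps)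
    \<comment> \<open>The monomials are quadratic, so the factor \<open>m * n\<close> enters
      squared; this is the origin of the square in \<open>G\<close>.\<close>
    have "quad_monomials (Z t) = (m * n)\<^sup>2 *\<^sub>R quad_monomials (z t)"
      by (simp only: vec_eq_iff quad_monomials_def vec_lambda_beta vector_scaleR_component Zz)
        (simp add: scaleR_conv_of_real power2_eq_square mult_ac)
    then show ?thesis by (simp add: G_def mn algebra_simps)
  qed
  have "G t = 0" for t
  proof -
    have poly_u: "poly_fun (\<lambda>t. u t $ i)" and poly_v: "poly_fun (\<lambda>t. v t $ i)" for i
      unfolding u_def v_def vector_add_component vector_smult_component
      by (intro poly_fun_add poly_fun_mult poly_fun_const poly_fun_of_real)+
    have poly_g: "poly_fun (\<lambda>t. g t $ i)" for i
      unfolding g_def by (simp, intro poly_fun_diff poly_fun_mult poly_fun_herm poly_u poly_v)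
    have poly_M: "poly_fun M" and poly_N: "poly_fun N"
      unfolding M_def N_def by (intro poly_fun_herm poly_u poly_g)+
    have "poly_fun G"
      unfolding G_def Z_def power2_eq_square
      by (intro poly_fun_diff poly_fun_mult poly_fun_const poly_fun_inner_quad_monomials
          poly_fun_spectral_mat poly_u poly_g poly_M poly_N)
    \<comment> \<open>The parameters at which the curve is a genuine point of the manifold. The
      segment from 0 to 1 may leave \<open>A\<close>: only a neighbourhood of 0 and the point 1
      matter, and the polynomial bridges any gap.\<close>
    define A where "A = {t. M t \<noteq> 0 \<and> N t \<noteq> 0}"
    have z_flag: "z t \<in> flagmf \<tau>" if "t \<in> A" for t
      using that spectral_mat_in_flagmf[OF assms(1) _ _ orth, of t]
      by (auto simp: A_def z_def M_def N_def \<alpha>_def \<beta>_def herm_self_eq_0_iff)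
    have "open A"
      unfolding A_def by (intro open_Collect_conj open_Collect_neq cont_M cont_N continuous_on_const)
    moreover have "openin (top_of_set A) (A \<inter> z -` U)"
    proof (rule continuous_openin_preimage[OF _ _ U(1)])
      show "continuous_on A z"
        unfolding z_def
        by (intro continuous_on_spectral_mat continuous_intros cont_M cont_N cont_u cont_g) (auto simp: A_def)
    qed (use z_flag in auto)
    ultimately have "open (A \<inter> z -` U)" by (simp add: openin_open_eq)
    moreover have "0 \<in> A \<inter> z -` U"
    proof -
      have "u 0 = u0" "v 0 = v0" by (simp_all add: u_def v_def)
      moreover from this have "g 0 = v0" using uv0(1) by (simp add: g_def orthonormal_pair_def)
      ultimately show ?thesis
        using uv0 y0 by (simp add: A_def z_def M_def N_def orthonormal_pair_def)
    qed
    ultimately obtain e where e: "0 < e" "ball 0 e \<subseteq> A \<inter> z -` U" unfolding open_contains_ball by blast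
    have "G s = 0" if s: "\<bar>s\<bar> < e" for s
    proof -
      have "s \<in> A" "z s \<in> U" using e(2) s by auto
      then show ?thesis using G_z[of s] eq[of "z s"] by (simp add: A_def)
    qed
    with \<open>poly_fun G\<close> e(1) show "G t = 0" by (rule poly_fun_eq_0)
  qed
  moreover have "M 1 = 1" "N 1 = 1" "z 1 = y"
  proof -
    have "u 1 = u1" "v 1 = v1" by (simp_all add: u_def v_def)
    moreover from this have "g 1 = v1" using uv1(1) by (simp add: g_def orthonormal_pair_def)
    ultimately show "M 1 = 1" "N 1 = 1" "z 1 = y"
      using uv1 by (simp_all add: z_def M_def N_def orthonormal_pair_def)
  qed
  ultimately show ?thesis using G_z[of 1] by (simp flip: of_real_diff)
qed

lemma bounded_continuous_image:
  fixes f :: "'a::heine_borel \<Rightarrow> 'b::metric_space"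
  assumes "bounded A" "continuous_on UNIV f"
  shows "bounded (f ` A)"
proof -
  have "compact (f ` closure A)"
    using assms by (intro compact_continuous_image continuous_on_subset[OF assms(2)]) auto
  then show ?thesis
    using bounded_subset[OF compact_imp_bounded image_mono[OF closure_subset]] by blast
qed

section \<open>Transfer of the abstract result to the flag manifold\<close>

theorem theorem6p1:
  fixes \<tau> :: real and \<rho> :: "(complex ^ 'n ^ 'n) measure"
  assumes "CARD('n) > 2" and "\<tau> > 1"
    and "minimizer \<tau> \<rho>"
  shows "generically_timelike \<tau> \<rho> \<or>
         (top_of_set (flagmf \<tau>)) interior_of (supp_on (flagmf \<tau>) \<rho>) = {}"
proof -
  note \<tau> = assms(2)
  let ?F = "flagmf \<tau> :: (complex ^ 'n ^ 'n) set"
  have reg: "regular_borel_on ?F \<rho>" and prob: "prob_space \<rho>"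
    and min: "action \<rho> = (INF \<sigma>\<in>(normalized_measures \<tau> :: (complex ^ 'n ^ 'n) measure set). action \<sigma>)"
    using assms(3) by (auto simp: minimizer_def normalized_measures_def)
  have D: "Dfun x y = D_coeffs x \<bullet> quad_monomials y" if "x \<in> ?F" "y \<in> ?F" for x y
    using that by (intro Dfun_eq_inner) (auto simp: flagmf_def)
  \<comment> \<open>The bilinear formula for \<open>Dfun\<close> is available for Hermitian
    matrices, and the measures live on the flag manifold, where all matrices are Hermitian.\<close>
  have action_eq: "action \<sigma> = (\<integral>p. max 0 (D_coeffs (fst p) \<bullet> quad_monomials (snd p)) \<partial>(\<sigma> \<Otimes>\<^sub>M \<sigma>))"
    if "regular_borel_on ?F \<sigma>" for \<sigma>
  proof -
    have "sets \<sigma> = sets (restrict_space borel ?F)" using that by (simp add: regular_borel_on_def)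
    from sets_eq_imp_space_eq[OF this] have "space \<sigma> = ?F" by (simp add: space_restrict_space)
    then show ?thesis
      unfolding action_def Lfun_def
      by (intro Bochner_Integration.integral_cong refl) (auto simp: space_pair_measure D)
  qed
  interpret causal_minimizer \<rho> ?F D_coeffs quad_monomials
  proof (intro causal_minimizer.intro causal_minimizer_axioms.intro)
    show "prob_space \<rho>" "regular_borel_on ?F \<rho>" by fact+
    show "continuous_on ?F D_coeffs" "continuous_on ?F quad_monomials"
      by (rule continuous_on_D_coeffs continuous_on_quad_monomials)+
    show "bounded (D_coeffs ` ?F)" "bounded (quad_monomials ` ?F)"
      by (intro bounded_continuous_image bounded_flagmf \<tau> continuous_on_D_coeffs continuous_on_quad_monomials)+
    show "D_coeffs x \<bullet> quad_monomials y = D_coeffs y \<bullet> quad_monomials x" if "x \<in> ?F" "y \<in> ?F" for x y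
      using Dfun_sym[of x y] that by (simp add: D)
    show "0 < D_coeffs x \<bullet> quad_monomials x" if "x \<in> ?F" for x
      using Dfun_diag[OF \<tau> that] \<tau> that by (simp add: D)
    show "w \<bullet> quad_monomials y = c"
      if "openin (top_of_set ?F) U" "U \<noteq> {}" "\<And>y. y \<in> U \<Longrightarrow> w \<bullet> quad_monomials y = c" "y \<in> ?F" for U w c y
      using flagmf_identity[OF \<tau> that] .
    show "(\<integral>p. max 0 (D_coeffs (fst p) \<bullet> quad_monomials (snd p)) \<partial>(\<rho> \<Otimes>\<^sub>M \<rho>)) \<le>
      (\<integral>p. max 0 (D_coeffs (fst p) \<bullet> quad_monomials (snd p)) \<partial>(\<sigma> \<Otimes>\<^sub>M \<sigma>))"
      if \<sigma>: "regular_borel_on ?F \<sigma>" "prob_space \<sigma>" for \<sigma>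
    proof -
      \<comment> \<open>A real infimum is a lower bound only for a set bounded below; here 0 serves,
        since the Lagrangian is nonnegative.\<close>
      have "bdd_below (action ` (normalized_measures \<tau> :: (complex ^ 'n ^ 'n) measure set))"
        unfolding action_def Lfun_def by (intro bdd_belowI2[of _ 0] integral_nonneg_AE AE_I2) simp
      then have "action \<rho> \<le> action \<sigma>"
        unfolding min using \<sigma> by (intro cINF_lower) (simp_all add: normalized_measures_def)
      then show ?thesis using action_eq[OF reg] action_eq[OF \<sigma>(1)] by simp
    qed
  qed
  show ?thesis
  proof (cases "(top_of_set ?F) interior_of (supp_on ?F \<rho>) = {}")
    case False
    have "0 \<le> Dfun x y" if "x \<in> supp" "y \<in> supp" for x y
      using timelike_if_interior(1)[OF False that] that by (simp add: D subsetD[OF supp_subset])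
    moreover have "(\<integral>y. Dfun x y \<partial>\<rho>) = S" if "x \<in> ?F" for x
    proof -
      have "(\<integral>y. Dfun x y \<partial>\<rho>) = (\<integral>y. D_coeffs x \<bullet> quad_monomials y \<partial>\<rho>)"
        using that by (intro Bochner_Integration.integral_cong) (auto simp: D)
      then show ?thesis using timelike_if_interior(2)[OF False that] by simp
    qed
    ultimately show ?thesis by (auto simp: generically_timelike_def constant_on_def)
  qed simp
qed

end
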